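(* Let $n\ge 4$. The number $|G(n,n-4)/Z_n|$ of cyclic equivalence classes of $(n-4)$-dissections (almost-triangulations) of a convex regular $n$-gon is \[ \frac{n-3}{2n}C_{n-2}+\frac{1}{2}C_{n/4-1}+\frac{1}{4}C_{n/2-1}. \]
   Context: For $n\ge 3$ and $0\le k\le n-3$, a $k$-dissection of a convex regular $n$-gon is a partition of it into $k+1$ polygons by $k$ pairwise non-crossing diagonals; $G(n,k)$ denotes the set of $k$-dissections (with vertices labelled $0,\dots,n-1$ in cyclic order, so dissections are distinct sets of diagonals). The cyclic group $Z_n$ acts on $G(n,k)$ by rotating the polygon (vertex $v\mapsto v+1 \bmod n$), and $G(n,k)/Z_n$ is the set of orbits. For a real number $m$, $C_m=\frac{1}{m+1}\binom{2m}{m}$ if $m$ is a nonnegative integer, and $C_m=0$ otherwise. (Equivalently, the count is the number of edges of the $(n-3)$-dimensional associahedron modulo the cyclic action.) *)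

theory Defs
  imports Complex_Main "HOL-Algebra.Group_Action" "HOL-Algebra.Elementary_Groups"
begin

text \<open>The vertices of the polygon are labelled by the integers \<open>0, \<dots>, n - 1\<close> in cyclic order.
  A diagonal is identified with the set of its two (distinct, non-adjacent) endpoints.\<close>

definition diagonals :: "nat \<Rightarrow> int set set" where
  "diagonals n = {{a, b} | a b. a \<in> {0..<int n} \<and> b \<in> {0..<int n} \<and> a \<noteq> b \<and>
     b \<noteq> (a + 1) mod int n \<and> a \<noteq> (b + 1) mod int n}"

text \<open>Two chords of a convex polygon meet in their relative interiors, without overlapping,
  iff their endpoints strictly alternate along the boundary.\<close>

definition crosses :: "int set \<Rightarrow> int set \<Rightarrow> bool" where
  "crosses d e \<longleftrightarrow> (\<exists>p q r s. p < q \<and> q < r \<and> r < s \<and>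
     (d = {p, r} \<and> e = {q, s} \<or> d = {q, s} \<and> e = {p, r}))"

definition dissections :: "nat \<Rightarrow> nat \<Rightarrow> int set set set" where
  "dissections n k =
     {D. D \<subseteq> diagonals n \<and> card D = k \<and> (\<forall>d\<in>D. \<forall>e\<in>D. \<not> crosses d e)}"

definition rotate_vertex :: "nat \<Rightarrow> int \<Rightarrow> int \<Rightarrow> int" where
  "rotate_vertex n g v = (v + g) mod int n"

text \<open>The restriction to \<open>dissections n k\<close> is what the library's \<open>group_action\<close>
  requires of an action.\<close>

definition rotation :: "nat \<Rightarrow> nat \<Rightarrow> int \<Rightarrow> int set set \<Rightarrow> int set set" where
  "rotation n k g = (\<lambda>D\<in>dissections n k. (\<lambda>d. rotate_vertex n g ` d) ` D)"

definition dissection_classes :: "nat \<Rightarrow> nat \<Rightarrow> int set set set set" where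
  "dissection_classes n k =
     orbits (integer_mod_group n) (dissections n k) (rotation n k)"

definition catalan :: "real \<Rightarrow> real" where
  "catalan m = (if m \<in> \<nat>
     then 1 / (m + 1) * real ((2 * nat \<lfloor>m\<rfloor>) choose nat \<lfloor>m\<rfloor>) else 0)"

lemma rotate_vertex_cases:
  assumes "v \<in> {0..<int n}" "g \<in> {0..<int n}"
  shows "rotate_vertex n g v = (if v + g < int n then v + g else v + g - int n)"
proof (cases "v + g < int n")
  case True
  then show ?thesis using assms by (simp add: rotate_vertex_def)
next
  case False
  then have "(v + g) mod int n = (v + g - int n) mod int n" by simp
  also have "\<dots> = v + g - int n" using assms False by (intro mod_pos_pos_trivial) auto
  finally show ?thesis using False by (simp add: rotate_vertex_def)
qed

lemma rotate_vertex_in: "n > 0 \<Longrightarrow> rotate_vertex n g v \<in> {0..<int n}"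
  by (simp add: rotate_vertex_def)

lemma rotate_vertex_add:
  "rotate_vertex n g (rotate_vertex n h v) = rotate_vertex n ((g + h) mod int n) v"
  by (simp add: rotate_vertex_def mod_simps add.commute add.left_commute)

lemma rotate_vertex_0: "v \<in> {0..<int n} \<Longrightarrow> rotate_vertex n 0 v = v"
  by (simp add: rotate_vertex_def)

lemma diagonals_subset: "d \<in> diagonals n \<Longrightarrow> d \<subseteq> {0..<int n}"
  by (auto simp: diagonals_def)

lemma rotate_vertex_Suc:
  "rotate_vertex n g ((a + 1) mod int n) = (rotate_vertex n g a + 1) mod int n"
  by (simp add: rotate_vertex_def mod_simps algebra_simps)

lemma rotate_vertex_inj:
  assumes "n > 0" "a \<in> {0..<int n}" "b \<in> {0..<int n}"
    "rotate_vertex n g a = rotate_vertex n g b"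
  shows "a = b"
proof -
  have "rotate_vertex n (- g) (rotate_vertex n g c) = c" if "c \<in> {0..<int n}" for c
    using that by (simp add: rotate_vertex_def mod_simps)
  then show ?thesis using assms by metis
qed

lemma rotate_diagonal:
  assumes "n > 0" "d \<in> diagonals n"
  shows "rotate_vertex n g ` d \<in> diagonals n"
proof -
  from assms(2) obtain a b where d: "d = {a, b}" and ab: "a \<in> {0..<int n}" "b \<in> {0..<int n}"
    "a \<noteq> b" "b \<noteq> (a + 1) mod int n" "a \<noteq> (b + 1) mod int n"
    unfolding diagonals_def by blast
  have "(c + 1) mod int n \<in> {0..<int n}" for c using assms(1) by simp
  then have "rotate_vertex n g a \<noteq> rotate_vertex n g b"
    "rotate_vertex n g b \<noteq> (rotate_vertex n g a + 1) mod int n"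
    "rotate_vertex n g a \<noteq> (rotate_vertex n g b + 1) mod int n"
    using rotate_vertex_inj[OF assms(1)] ab rotate_vertex_Suc by metis+
  then show ?thesis unfolding diagonals_def d using rotate_vertex_in[OF assms(1)] by auto
qed

lemma crosses_sym: "crosses d e \<longleftrightarrow> crosses e d"
  unfolding crosses_def by blast

lemma crossesI: "p < q \<Longrightarrow> q < r \<Longrightarrow> r < s \<Longrightarrow> crosses {p, r} {q, s}"
  unfolding crosses_def by blast

lemma crosses_rotate_aux:
  assumes "{p, q, r, s} \<subseteq> {0..<int n}" "g \<in> {0..<int n}" "p < q" "q < r" "r < s"
  shows "crosses (rotate_vertex n g ` {p, r}) (rotate_vertex n g ` {q, s})"
proof -
  let ?f = "rotate_vertex n g"
  have f: "?f x = (if x + g < int n then x + g else x + g - int n)" if "x \<in> {p, q, r, s}" for x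
    using rotate_vertex_cases that assms by blast
  have "?f p < ?f q \<and> ?f q < ?f r \<and> ?f r < ?f s \<or>
        ?f q < ?f r \<and> ?f r < ?f s \<and> ?f s < ?f p \<or>
        ?f r < ?f s \<and> ?f s < ?f p \<and> ?f p < ?f q \<or>
        ?f s < ?f p \<and> ?f p < ?f q \<and> ?f q < ?f r"
    using assms f[of p] f[of q] f[of r] f[of s] by (auto split: if_splits)
  then show ?thesis
    using crossesI[of "?f p" "?f q" "?f r" "?f s"] crossesI[of "?f q" "?f r" "?f s" "?f p"]
      crossesI[of "?f r" "?f s" "?f p" "?f q"] crossesI[of "?f s" "?f p" "?f q" "?f r"]
    by (auto simp: insert_commute crosses_sym)
qed

lemma crosses_rotate:
  assumes "d \<subseteq> {0..<int n}" "e \<subseteq> {0..<int n}" "g \<in> {0..<int n}" "crosses d e"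
  shows "crosses (rotate_vertex n g ` d) (rotate_vertex n g ` e)"
proof -
  from assms(4) obtain p q r s where *: "p < q" "q < r" "r < s"
    and de: "d = {p, r} \<and> e = {q, s} \<or> d = {q, s} \<and> e = {p, r}"
    unfolding crosses_def by blast
  then have "{p, q, r, s} \<subseteq> {0..<int n}" using assms(1,2) by auto
  from crosses_rotate_aux[OF this assms(3) *] show ?thesis using de crosses_sym by metis
qed

lemma rotate_set_add:
  "(\<lambda>d. rotate_vertex n g ` d) ` (\<lambda>d. rotate_vertex n h ` d) ` D =
     (\<lambda>d. rotate_vertex n ((g + h) mod int n) ` d) ` D"
  by (simp add: image_image rotate_vertex_add)

lemma rotate_set_0:
  assumes "D \<subseteq> diagonals n"
  shows "(\<lambda>d. rotate_vertex n 0 ` d) ` D = D"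
proof -
  have "rotate_vertex n 0 ` d = d" if "d \<in> D" for d
  proof -
    have "\<And>v. v \<in> d \<Longrightarrow> rotate_vertex n 0 v = v"
      using diagonals_subset[of d n] that assms rotate_vertex_0 by blast
    then show ?thesis by force
  qed
  then show ?thesis by force
qed

lemma rotate_dissection:
  assumes n: "n > 0" and g: "g \<in> {0..<int n}" and D: "D \<in> dissections n k"
  shows "(\<lambda>d. rotate_vertex n g ` d) ` D \<in> dissections n k"
proof -
  let ?R = "\<lambda>g d. rotate_vertex n g ` d"
  let ?h = "(- g) mod int n"
  have h: "?h \<in> {0..<int n}" using n by simp
  have hg: "(?h + g) mod int n = 0" by (simp add: mod_simps)
  have sub: "D \<subseteq> diagonals n" using D by (simp add: dissections_def)
  have undo_rot: "?R ?h (?R g d) = d" if "d \<in> D" for d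
  proof -
    have "?R ?h (?R g d) = ?R 0 d" by (simp only: image_image rotate_vertex_add hg)
    also have "\<dots> = d" using rotate_set_0[of "{d}" n] that sub by auto
    finally show ?thesis .
  qed
  have "inj_on (?R g) D" by (metis undo_rot inj_onI)
  moreover have "?R g ` D \<subseteq> diagonals n" using rotate_diagonal[OF n] sub by blast
  moreover have "\<not> crosses (?R g d) (?R g e)" if de: "d \<in> D" "e \<in> D" for d e
  proof
    assume c: "crosses (?R g d) (?R g e)"
    have "?R g d \<subseteq> {0..<int n}" "?R g e \<subseteq> {0..<int n}"
      using rotate_vertex_in[OF n] by blast+
    from crosses_rotate[OF this h c] have "crosses d e" using undo_rot de by simp
    then show False using D de by (auto simp: dissections_def)
  qed
  ultimately show ?thesis using D by (auto simp: dissections_def card_image)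
qed

lemma rotation_group_action:
  assumes n: "n > 0"
  shows "group_action (integer_mod_group n) (dissections n k) (rotation n k)"
proof -
  let ?E = "dissections n k"
  let ?R = "\<lambda>g D. (\<lambda>d. rotate_vertex n g ` d) ` D"
  have carr: "carrier (integer_mod_group n) = {0..<int n}"
    using n by (simp add: carrier_integer_mod_group)
  have inv: "?R g (?R h D) = D" if "D \<in> ?E" "(g + h) mod int n = 0" for g h D
    using that rotate_set_add[of n g h D] rotate_set_0[of D n] by (simp add: dissections_def)
  have bij: "rotation n k g \<in> Bij ?E" if g: "g \<in> {0..<int n}" for g
  proof -
    let ?h = "(- g) mod int n"
    have h: "?h \<in> {0..<int n}" using n by simp
    have "bij_betw (?R g) ?E ?E"
      by (rule bij_betw_byWitness[where f' = "?R ?h"])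
        (use rotate_dissection[OF n g] rotate_dissection[OF n h] inv in
          \<open>auto simp: mod_simps image_subset_iff\<close>)
    then show ?thesis
      unfolding Bij_def rotation_def by (simp cong: bij_betw_cong)
  qed
  have "rotation n k ((g + h) mod int n) = compose ?E (rotation n k g) (rotation n k h)"
    if "g \<in> {0..<int n}" "h \<in> {0..<int n}" for g h
    using rotate_dissection[OF n that(2)] rotate_set_add[of n g h]
    by (auto simp: rotation_def compose_def restrict_def fun_eq_iff)
  then have "rotation n k \<in> hom (integer_mod_group n) (BijGroup ?E)"
    using bij by (auto simp: hom_def carr BijGroup_def)
  then show ?thesis
    by (simp add: group_action_def group_hom_def group_hom_axioms_def group_BijGroup)
qed

end

theory Submission
  imports Defs "HOL-Computational_Algebra.Formal_Power_Series"
begin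

text \<open>
  An almost-triangulation \<open>D\<close> has a single quadrilateral cell, so exactly two diagonals can be added
  to it, and these two cross. Counting pairs \<open>(D, e)\<close> with \<open>e\<close> addable to \<open>D\<close> relates the
  almost-triangulations to the triangulations. By Burnside's lemma it remains to count the fixed
  points of each rotation. A rotation fixing \<open>D\<close> permutes the four corners of the quadrilateral,
  hence has order 1, 2 or 4. For order 2 the two addable diagonals are diameters, and \<open>D\<close> is
  determined by a diameter and a triangulation of one half; each \<open>D\<close> arises from two diameters.
  For order 4 the quadrilateral is a square, and \<open>D\<close> is determined by the square and a
  triangulation of one of the four outer parts.
\<close>

section \<open>Noncrossing families of arcs over an interval\<close>

text \<open>Cells never appear as objects. The quadrilateral of \<open>D\<close> is represented by
  \<open>completions n D\<close>, the set of its two addable diagonals, whose endpoints are the four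
  corners. This set is defined from crossings alone, so it rotates together with \<open>D\<close>
  (\<open>completions_turn\<close>), and every symmetry argument goes through it. That it consists
  of exactly two crossing diagonals is proved on an interval instead of the polygon: a family over
  an interval can be cut into families of the same kind over two shorter intervals, which opens the
  way to induction, whereas the cyclic picture has no distinguished place to cut. The coefficients
  come from the Burnside sum. The identity contributes \<open>(n - 3) / 2\<close> times the Catalan
  number of index \<open>n - 2\<close>. The half turn contributes \<open>n / 2\<close> diameters
  times the Catalan number of index \<open>n / 2 - 1\<close>, halved. Each of the two quarter turns
  contributes \<open>n / 4\<close> squares times the Catalan number of index
  \<open>n / 4 - 1\<close>. Division by \<open>n\<close> leaves \<open>(n - 3) / (2 * n)\<close>,
  \<open>1 / 4\<close> and \<open>1 / 2\<close>.\<close>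

text \<open>An arc is a pair \<open>(x, y)\<close> with \<open>x < y\<close>. The members of \<open>fam a b\<close> are dissections of the polygon
  with vertices \<open>a, \<dots>, b\<close>, with the sides of the polygon included as arcs; \<open>full a b\<close> consists of
  the triangulations.\<close>

definition crossing :: "int \<times> int \<Rightarrow> int \<times> int \<Rightarrow> bool" where
  "crossing s t \<longleftrightarrow> fst s < fst t \<and> fst t < snd s \<and> snd s < snd t"

text \<open>\<open>crossing\<close> is one-sided: the second arc starts inside the first and leaves
  it to the right. Quantifying over ordered pairs recovers the symmetric notion.\<close>

definition noncrossing :: "(int \<times> int) set \<Rightarrow> bool" where
  "noncrossing S \<longleftrightarrow> (\<forall>s\<in>S. \<forall>t\<in>S. \<not> crossing s t)"

definition arcs :: "int \<Rightarrow> int \<Rightarrow> (int \<times> int) set" where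
  "arcs a b = {(x, y). a \<le> x \<and> x < y \<and> y \<le> b}"

definition fam :: "int \<Rightarrow> int \<Rightarrow> (int \<times> int) set set" where
  "fam a b = {S. S \<subseteq> arcs a b \<and> noncrossing S \<and> (a, b) \<in> S \<and>
     (\<forall>x. a \<le> x \<and> x < b \<longrightarrow> (x, x + 1) \<in> S)}"

definition full :: "int \<Rightarrow> int \<Rightarrow> (int \<times> int) set set" where
  "full a b = {S \<in> fam a b. int (card S) = 2 * (b - a) - 1}"

lemma noncrossingD:
  "noncrossing S \<Longrightarrow> (x, y) \<in> S \<Longrightarrow> (u, v) \<in> S \<Longrightarrow> x < u \<Longrightarrow> u < y \<Longrightarrow> v \<le> y"
  unfolding noncrossing_def crossing_def by force

lemma noncrossing_subset: "noncrossing T \<Longrightarrow> S \<subseteq> T \<Longrightarrow> noncrossing S"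
  unfolding noncrossing_def by blast

lemma noncrossing_insert:
  "noncrossing (insert t S) \<longleftrightarrow>
     noncrossing S \<and> (\<forall>s\<in>S. \<not> crossing s t \<and> \<not> crossing t s)"
  unfolding noncrossing_def crossing_def by auto

lemma arcs_iff [simp]: "(x, y) \<in> arcs a b \<longleftrightarrow> a \<le> x \<and> x < y \<and> y \<le> b"
  by (simp add: arcs_def)

lemma finite_arcs [simp]: "finite (arcs a b)"
  by (rule finite_subset[of _ "{a..b} \<times> {a..b}"]) (auto simp: arcs_def)

lemma famD:
  assumes "S \<in> fam a b"
  shows "S \<subseteq> arcs a b" "noncrossing S" "(a, b) \<in> S"
    "\<And>x. a \<le> x \<Longrightarrow> x < b \<Longrightarrow> (x, x + 1) \<in> S" "a < b" "finite S"
  using assms finite_subset[OF _ finite_arcs, of S a b] by (auto simp: fam_def)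

lemma finite_fam [simp]: "finite (fam a b)"
  by (rule finite_subset[of _ "Pow (arcs a b)"]) (auto simp: fam_def)

lemma finite_full [simp]: "finite (full a b)"
  by (rule finite_subset[of _ "fam a b"]) (auto simp: full_def)

lemma fam_insert:
  assumes "S \<in> fam a b" "t \<in> arcs a b" "noncrossing (insert t S)"
  shows "insert t S \<in> fam a b"
  using assms by (auto simp: fam_def)

lemma noncrossing_insert_outer:
  assumes "noncrossing S" "S \<subseteq> arcs a b"
  shows "noncrossing (insert (a, b) S)"
  using assms by (force simp: noncrossing_insert crossing_def)

text \<open>The cut point \<open>c\<close> is the largest neighbour of \<open>a\<close> below
  \<open>b\<close>; the side \<open>(a, a + 1)\<close> guarantees that there is one. An arc from
  \<open>a\<close> beyond \<open>c\<close> other than \<open>(a, b)\<close> contradicts maximality,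
  and one starting strictly between \<open>a\<close> and \<open>c\<close> and ending beyond
  \<open>c\<close> would cross \<open>(a, c)\<close>. The arc \<open>(c, b)\<close> may be absent
  from \<open>S\<close>, hence the \<open>insert\<close> in the right part.\<close>

lemma fam_split:
  assumes S: "S \<in> fam a b" and ab: "a + 1 < b"
  obtains c where "a < c" "c < b" "(a, c) \<in> S"
    "S \<inter> arcs a c \<in> fam a c" "insert (c, b) (S \<inter> arcs c b) \<in> fam c b"
    "S = insert (a, b) (S \<inter> arcs a c \<union> S \<inter> arcs c b)"
proof -
  note * = famD[OF S]
  define C where "C = {c. c < b \<and> (a, c) \<in> S}"
  have Csub: "C \<subseteq> {a<..<b}" using *(1) by (auto simp: C_def)
  then have fin: "finite C" by (rule finite_subset) auto
  have "a + 1 \<in> C" using *(4)[of a] ab by (simp add: C_def)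
  define c where "c = Max C"
  have "c \<in> C" unfolding c_def using fin \<open>a + 1 \<in> C\<close> by (intro Max_in) auto
  then have c: "a < c" "c < b" "(a, c) \<in> S" using Csub by (auto simp: C_def)
  have cmax: "y \<le> c" if "(a, y) \<in> S" "y < b" for y
    unfolding c_def using fin that by (intro Max_ge) (auto simp: C_def)
  have dec: "S = insert (a, b) (S \<inter> arcs a c \<union> S \<inter> arcs c b)"
  proof -
    have "(x, y) = (a, b) \<or> (x, y) \<in> arcs a c \<or> (x, y) \<in> arcs c b" if xy: "(x, y) \<in> S" for x y
    proof -
      have r: "a \<le> x" "x < y" "y \<le> b" using xy *(1) by auto
      consider "x = a" | "a < x" "x < c" | "c \<le> x" using r by linarith
      then show ?thesis
      proof cases
        case 1
        then show ?thesis using cmax xy r by force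
      next
        case 2
        then show ?thesis using noncrossingD[OF *(2) c(3) xy] r by auto
      next
        case 3
        then show ?thesis using r by auto
      qed
    qed
    then have "S \<subseteq> insert (a, b) (S \<inter> arcs a c \<union> S \<inter> arcs c b)"
      by (intro subrelI) blast
    then show ?thesis using *(3) by blast
  qed
  have "S \<inter> arcs a c \<in> fam a c"
    using * c by (auto simp: fam_def intro: noncrossing_subset)
  moreover have "insert (c, b) (S \<inter> arcs c b) \<in> fam c b"
    using * c noncrossing_insert_outer[of "S \<inter> arcs c b" c b]
    by (auto simp: fam_def intro: noncrossing_subset)
  ultimately show ?thesis using that c dec by blast
qed

lemma fam_join:
  assumes "S1 \<in> fam a c" "S2 \<in> fam c b"
  shows "insert (a, b) (S1 \<union> S2) \<in> fam a b"
proof -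
  note 1 = famD[OF assms(1)] and 2 = famD[OF assms(2)]
  have "noncrossing (S1 \<union> S2)"
  proof -
    have "\<not> crossing s t" if "s \<in> S1 \<union> S2" "t \<in> S1 \<union> S2" for s t
      using that 1(1,2) 2(1,2) unfolding noncrossing_def crossing_def by (cases s; cases t) force
    then show ?thesis by (simp add: noncrossing_def)
  qed
  moreover have "S1 \<union> S2 \<subseteq> arcs a b" using 1(1,5) 2(1,5) by force
  moreover have "(x, x + 1) \<in> S1 \<union> S2" if "a \<le> x" "x < b" for x
    using 1(4)[of x] 2(4)[of x] that by force
  ultimately show ?thesis
    using noncrossing_insert_outer[of "S1 \<union> S2" a b] 1(5) 2(5) by (simp add: fam_def)
qed

lemma card_insert_Un_arcs:
  assumes "S1 \<subseteq> arcs a c" "S2 \<subseteq> arcs c b" "a < c" "c < b"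
  shows "card (insert (a, b) (S1 \<union> S2)) = 1 + card S1 + card S2"
proof -
  have "finite S1" "finite S2" using assms finite_subset finite_arcs by metis+
  moreover have "S1 \<inter> S2 = {}" "(a, b) \<notin> S1 \<union> S2" using assms by force+
  ultimately show ?thesis by (simp add: card_Un_disjoint)
qed

text \<open>With \<open>m = b - a \<ge> 2\<close> the polygon has \<open>m + 1\<close> sides and at
  most \<open>m - 2\<close> noncrossing diagonals, in total \<open>2 * m - 1\<close>. The bound is
  reproduced by the split, since
  \<open>1 + (2 * (c - a) - 1) + (2 * (b - c) - 1) = 2 * (b - a) - 1\<close>.\<close>

lemma card_fam_le:
  assumes "S \<in> fam a b"
  shows "int (card S) \<le> 2 * (b - a) - 1"
  using assms
proof (induction "nat (b - a)" arbitrary: a b S rule: less_induct)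
  case less
  note * = famD[OF less.prems]
  show ?case
  proof (cases "a + 1 < b")
    case False
    then have "b = a + 1" using *(5) by simp
    then have "S \<subseteq> {(a, b)}" using *(1) by (force simp: arcs_def)
    then have "card S \<le> 1" using card_mono[of "{(a, b)}" S] by simp
    then show ?thesis using \<open>b = a + 1\<close> by simp
  next
    case True
    from fam_split[OF less.prems True] obtain c where c: "a < c" "c < b"
      "S \<inter> arcs a c \<in> fam a c" "insert (c, b) (S \<inter> arcs c b) \<in> fam c b"
      and dec: "S = insert (a, b) (S \<inter> arcs a c \<union> S \<inter> arcs c b)" by metis
    have "int (card (S \<inter> arcs a c)) \<le> 2 * (c - a) - 1"
      using less.hyps[OF _ c(3)] c by simp
    moreover have "int (card (insert (c, b) (S \<inter> arcs c b))) \<le> 2 * (b - c) - 1"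
      using less.hyps[OF _ c(4)] c by simp
    moreover have "card (S \<inter> arcs c b) \<le> card (insert (c, b) (S \<inter> arcs c b))"
      by (rule card_insert_le)
    ultimately show ?thesis
      using card_insert_Un_arcs[of "S \<inter> arcs a c" a c "S \<inter> arcs c b" b] c dec by simp
  qed
qed

lemma full_no_extension:
  assumes "S \<in> full a b" "t \<in> arcs a b" "noncrossing (insert t S)"
  shows "t \<in> S"
proof (rule ccontr)
  assume "t \<notin> S"
  moreover have "insert t S \<in> fam a b" using assms fam_insert by (simp add: full_def)
  ultimately show False
    using card_fam_le[of "insert t S" a b] assms(1) famD(6)[of S a b] by (simp add: full_def)
qed

text \<open>Equality must hold in both estimates behind \<open>card_fam_le\<close>. If
  \<open>(c, b)\<close> were missing, the right part would fall short by one, so it is present and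
  both parts are full.\<close>

lemma full_split:
  assumes S: "S \<in> full a b" and ab: "a + 1 < b"
  obtains c where "a < c" "c < b" "S \<inter> arcs a c \<in> full a c" "S \<inter> arcs c b \<in> full c b"
    "S = insert (a, b) (S \<inter> arcs a c \<union> S \<inter> arcs c b)"
proof -
  have Sf: "S \<in> fam a b" and card: "int (card S) = 2 * (b - a) - 1"
    using S by (simp_all add: full_def)
  from fam_split[OF Sf ab] obtain c where c: "a < c" "c < b"
    "S \<inter> arcs a c \<in> fam a c" "insert (c, b) (S \<inter> arcs c b) \<in> fam c b"
    and dec: "S = insert (a, b) (S \<inter> arcs a c \<union> S \<inter> arcs c b)" by metis
  have sum: "card S = 1 + card (S \<inter> arcs a c) + card (S \<inter> arcs c b)"
    using card_insert_Un_arcs[of "S \<inter> arcs a c" a c "S \<inter> arcs c b" b] c dec by simp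
  have fin: "finite (S \<inter> arcs c b)" by simp
  have "(c, b) \<in> S \<inter> arcs c b"
  proof (rule ccontr)
    assume "(c, b) \<notin> S \<inter> arcs c b"
    then have "card (insert (c, b) (S \<inter> arcs c b)) = Suc (card (S \<inter> arcs c b))"
      using fin by simp
    then show False using card_fam_le[OF c(3)] card_fam_le[OF c(4)] sum card by simp
  qed
  then have c4: "S \<inter> arcs c b \<in> fam c b" using c(4) by (simp add: insert_absorb)
  have "S \<inter> arcs a c \<in> full a c" "S \<inter> arcs c b \<in> full c b"
    using card_fam_le[OF c(3)] card_fam_le[OF c4] c(3) c4 sum card by (simp_all add: full_def)
  then show ?thesis using that c dec by blast
qed

lemma full_unit: "full a (a + 1) = {{(a, a + 1)}}"
proof -
  have "fam a (a + 1) = {{(a, a + 1)}}"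
  proof -
    have "arcs a (a + 1) = {(a, a + 1)}" by (force simp: arcs_def)
    then show ?thesis by (auto simp: fam_def noncrossing_def crossing_def)
  qed
  then show ?thesis by (auto simp: full_def)
qed

text \<open>The Catalan recurrence: \<open>c\<close> is the apex of the triangle over
  \<open>(a, b)\<close>. It can be read off the joined family as the largest neighbour of
  \<open>a\<close> below \<open>b\<close>, which makes the joining map injective.\<close>

lemma card_full_rec:
  assumes ab: "a + 1 < b"
  shows "card (full a b) = (\<Sum>c\<in>{a<..<b}. card (full a c) * card (full c b))"
proof -
  define J where "J = (\<lambda>(c :: int, S1, S2). insert (a, b) (S1 \<union> S2) :: (int \<times> int) set)"
  let ?X = "SIGMA c:{a<..<b}. full a c \<times> full c b"
  have restr: "J (c, S1, S2) \<inter> arcs a c = S1" "J (c, S1, S2) \<inter> arcs c b = S2"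
    "(a, c) \<in> J (c, S1, S2)" "\<And>y. (a, y) \<in> J (c, S1, S2) \<Longrightarrow> y < b \<Longrightarrow> y \<le> c"
    if "(c, S1, S2) \<in> ?X" for c S1 S2
  proof -
    have c: "a < c" "c < b" and f: "S1 \<in> fam a c" "S2 \<in> fam c b"
      using that by (auto simp: full_def)
    note 1 = famD[OF f(1)] and 2 = famD[OF f(2)]
    show "J (c, S1, S2) \<inter> arcs a c = S1" "J (c, S1, S2) \<inter> arcs c b = S2"
      using c 1(1) 2(1) by (force simp: J_def)+
    show "(a, c) \<in> J (c, S1, S2)" using 1(3) by (simp add: J_def)
    show "y \<le> c" if "(a, y) \<in> J (c, S1, S2)" "y < b" for y
      using that c 1(1) 2(1) by (force simp: J_def)
  qed
  have inj: "inj_on J ?X"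
  proof (rule inj_onI)
    fix P Q assume PQ: "P \<in> ?X" "Q \<in> ?X" "J P = J Q"
    obtain c S1 S2 c' S1' S2' where P: "P = (c, S1, S2)" and Q: "Q = (c', S1', S2')"
      by (cases P; cases Q) auto
    have X: "(c, S1, S2) \<in> ?X" "(c', S1', S2') \<in> ?X" and b: "c < b" "c' < b"
      and eq: "J (c, S1, S2) = J (c', S1', S2')"
      using PQ P Q by auto
    have "c \<le> c'" using restr(4)[OF X(2), of c] restr(3)[OF X(1)] eq b by simp
    moreover have "c' \<le> c" using restr(4)[OF X(1), of c'] restr(3)[OF X(2)] eq b by simp
    ultimately have "c = c'" by simp
    then show "P = Q"
      unfolding P Q using restr(1,2)[OF X(1)] restr(1,2)[OF X(2)] eq by metis
  qed
  have "J ` ?X = full a b"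
  proof (rule antisym)
    show "J ` ?X \<subseteq> full a b"
    proof (clarify)
      fix c S1 S2 assume c: "c \<in> {a<..<b}" and S: "S1 \<in> full a c" "S2 \<in> full c b"
      have "int (card (insert (a, b) (S1 \<union> S2))) = 1 + int (card S1) + int (card S2)"
        using card_insert_Un_arcs[of S1 a c S2 b] famD(1) S c by (simp add: full_def)
      then show "J (c, S1, S2) \<in> full a b"
        using fam_join[of S1 a c S2 b] S by (simp add: full_def J_def)
    qed
    show "full a b \<subseteq> J ` ?X"
    proof
      fix S assume "S \<in> full a b"
      from full_split[OF this ab] obtain c where "a < c" "c < b" "S \<inter> arcs a c \<in> full a c"
        "S \<inter> arcs c b \<in> full c b" "S = insert (a, b) (S \<inter> arcs a c \<union> S \<inter> arcs c b)" .
      then show "S \<in> J ` ?X"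
        by (intro image_eqI[of _ _ "(c, S \<inter> arcs a c, S \<inter> arcs c b)"]) (auto simp: J_def)
    qed
  qed
  then have "card (full a b) = card ?X" using card_image[OF inj] by simp
  also have "\<dots> = (\<Sum>c\<in>{a<..<b}. card (full a c) * card (full c b))"
    by (subst card_SigmaI) (auto simp: card_cartesian_product)
  finally show ?thesis .
qed

section \<open>Catalan numbers\<close>

lemma catalan_of_nat: "catalan (real k) = real ((2 * k) choose k) / (real k + 1)"
  by (simp add: catalan_def)

lemma catalan_0: "catalan 0 = 1"
  using catalan_of_nat[of 0] by simp

lemma catalan_Suc:
  "catalan (real (Suc k)) = catalan (real k) * (4 * real k + 2) / (real k + 2)"
proof -
  define X Y where "X = real (Suc (2 * k) choose Suc k)" and "Y = real (2 * k choose k)"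
  have "real (Suc k) * X = real (Suc (2 * k)) * Y"
    unfolding X_def Y_def
    using arg_cong[OF Suc_times_binomial_eq[of "2 * k" k], of real]
    by (simp only: of_nat_mult mult.commute)
  then have X: "X = (2 * real k + 1) * Y / (real k + 1)" by (simp add: field_simps)
  have e: "real ((2 * Suc k) choose Suc k) = 2 * X"
  proof -
    have "(2 * Suc k) choose Suc k = (Suc (2 * k) choose k) + (Suc (2 * k) choose Suc k)" by simp
    moreover have "Suc (2 * k) choose k = Suc (2 * k) choose Suc k"
      using binomial_symmetric[of k "Suc (2 * k)"] by simp
    ultimately show ?thesis by (simp add: X_def)
  qed
  have "catalan (real (Suc k)) = 2 * ((2 * real k + 1) * Y / (real k + 1)) / (real k + 2)"
    unfolding catalan_of_nat e X by simp
  then show ?thesis by (simp add: catalan_of_nat Y_def algebra_simps)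
qed

text \<open>The numbers \<open>((1/2) gchoose k) * (- 4) ^ k\<close> are the coefficients of the
  square root of \<open>1 - 4 * x\<close>; this is the generating function
  \<open>(1 - sqrt (1 - 4 * x)) / (2 * x)\<close> read off coefficientwise.\<close>

lemma catalan_gbinomial:
  "catalan (real k) = - (((1 / 2) gchoose Suc k) * (- 4) ^ Suc k) / 2"
proof (induction k)
  case 0
  then show ?case by (simp add: catalan_0)
next
  case (Suc k)
  have "(real k + 2) * ((1 / 2 :: real) gchoose Suc (Suc k)) =
      (1 / 2 - (real k + 1)) * ((1 / 2) gchoose Suc k)"
    using gbinomial_absorb_comp[of "1 / 2 :: real" "Suc k"]
      gbinomial_absorption[of "Suc k" "1 / 2 :: real"] by (simp add: algebra_simps)
  then have G: "((1 / 2 :: real) gchoose Suc (Suc k)) =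
      (1 / 2 - (real k + 1)) * ((1 / 2) gchoose Suc k) / (real k + 2)"
    by (simp add: field_simps)
  show ?case unfolding catalan_Suc Suc G by (simp add: field_simps)
qed

text \<open>The square of \<open>sqrt (1 - 4 * x)\<close> has no term of degree
  \<open>m \<ge> 2\<close>. In the Vandermonde sum for that coefficient the two end terms give
  \<open>2 * B m\<close>, and the inner terms are four times the convolution. The indices
  \<open>k - 1\<close> and \<open>m - k - 1\<close> belong to intervals of lengths \<open>k\<close>
  and \<open>m - k\<close>.\<close>

lemma catalan_convolution:
  assumes "m \<ge> 2"
  shows "(\<Sum>k=1..<m. catalan (real (k - 1)) * catalan (real (m - k - 1))) = catalan (real (m - 1))"
proof -
  define B where "B = (\<lambda>k. ((1 / 2 :: real) gchoose k) * (- 4) ^ k)"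
  have cat: "catalan (real (k - 1)) = - B k / 2" if "k \<ge> 1" for k
    using that catalan_gbinomial[of "k - 1"] by (simp add: B_def)
  have "(\<Sum>k=0..m. B k * B (m - k)) =
      (\<Sum>k=0..m. ((1 / 2) gchoose k) * ((1 / 2) gchoose (m - k))) * (- 4) ^ m"
    unfolding sum_distrib_right
  proof (rule sum.cong)
    fix k assume "k \<in> {0..m}"
    then have "(- 4 :: real) ^ m = (- 4) ^ k * (- 4) ^ (m - k)" by (simp flip: power_add)
    then show "B k * B (m - k) = ((1 / 2) gchoose k) * ((1 / 2) gchoose (m - k)) * (- 4) ^ m"
      by (simp add: B_def)
  qed simp
  also have "(\<Sum>k=0..m. ((1 / 2 :: real) gchoose k) * ((1 / 2) gchoose (m - k))) = of_nat 1 gchoose m"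
    by (subst gbinomial_Vandermonde) simp
  also have "\<dots> = 0" using assms by (simp only: binomial_gbinomial[symmetric]) simp
  finally have "(\<Sum>k=0..m. B k * B (m - k)) = 0" by simp
  moreover have "{0..m} = insert 0 (insert m {1..<m})" using assms by auto
  moreover have "B 0 = 1" by (simp add: B_def)
  ultimately have "2 * B m + (\<Sum>k=1..<m. B k * B (m - k)) = 0" using assms by simp
  moreover have "(\<Sum>k=1..<m. catalan (real (k - 1)) * catalan (real (m - k - 1))) =
      (\<Sum>k=1..<m. B k * B (m - k)) / 4"
    unfolding sum_divide_distrib
  proof (rule sum.cong)
    fix k assume "k \<in> {1..<m}"
    then have "k \<ge> 1" "m - k \<ge> 1" by auto
    then show "catalan (real (k - 1)) * catalan (real (m - k - 1)) = B k * B (m - k) / 4"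
      by (simp only: cat)
  qed simp
  ultimately show ?thesis using cat[of m] assms by simp
qed

text \<open>Both sides satisfy the same recurrence in the length \<open>b - a\<close>. An interval
  of length \<open>m\<close> carries a polygon with \<open>m + 1\<close> vertices, which is why the
  index is \<open>m - 1\<close>.\<close>

lemma card_full:
  assumes "a < b"
  shows "real (card (full a b)) = catalan (of_int (b - a - 1))"
  using assms
proof (induction "nat (b - a)" arbitrary: a b rule: less_induct)
  case less
  show ?case
  proof (cases "a + 1 < b")
    case False
    then have "b = a + 1" using less.prems by simp
    then show ?thesis by (simp add: full_unit catalan_0)
  next
    case True
    define m where "m = nat (b - a)"
    have m: "m \<ge> 2" "b = a + int m" using True by (auto simp: m_def)
    have IH: "real (card (full x y)) = catalan (of_int (y - x - 1))" if "x < y" "y - x < b - a" for x y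
      using less.hyps[of y x] that by simp
    have "real (card (full a b)) = (\<Sum>c\<in>{a<..<b}. real (card (full a c)) * real (card (full c b)))"
      by (simp add: card_full_rec[OF True])
    also have "\<dots> = (\<Sum>c\<in>{a<..<b}. catalan (of_int (c - a - 1)) * catalan (of_int (b - c - 1)))"
      by (rule sum.cong) (auto simp: IH)
    also have "\<dots> = (\<Sum>k=1..<m. catalan (real (k - 1)) * catalan (real (m - k - 1)))"
    proof (rule sum.reindex_bij_witness[of _ "\<lambda>k. a + int k" "\<lambda>c. nat (c - a)"], goal_cases)
      case (5 c)
      then have "int (nat (c - a) - 1) = c - a - 1" "int (m - nat (c - a) - 1) = b - c - 1"
        using m by auto
      then show ?case by (metis of_int_of_nat_eq)
    qed (use m in auto)
    also have "\<dots> = catalan (real (m - 1))" using catalan_convolution[OF m(1)] .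
    also have "real (m - 1) = of_int (b - a - 1)" using m by (simp add: of_nat_diff)
    finally show ?thesis .
  qed
qed

section \<open>The two ways to complete a family that misses one arc\<close>

definition addable :: "int \<Rightarrow> int \<Rightarrow> (int \<times> int) set \<Rightarrow> (int \<times> int) set" where
  "addable a b S = {t \<in> arcs a b - S. noncrossing (insert t S)}"

lemma addableD:
  assumes "(u, v) \<in> addable a b S"
  shows "a \<le> u" "u < v" "v \<le> b" "(u, v) \<notin> S"
    "\<And>x y. (x, y) \<in> S \<Longrightarrow> x < u \<Longrightarrow> u < y \<Longrightarrow> v \<le> y"
    "\<And>x y. (x, y) \<in> S \<Longrightarrow> u < x \<Longrightarrow> x < v \<Longrightarrow> y \<le> v"
  using assms by (auto simp: addable_def noncrossing_insert crossing_def)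

lemma addableI:
  assumes "noncrossing S" "a \<le> u" "u < v" "v \<le> b" "(u, v) \<notin> S"
    "\<And>x y. (x, y) \<in> S \<Longrightarrow> x < u \<Longrightarrow> u < y \<Longrightarrow> v \<le> y"
    "\<And>x y. (x, y) \<in> S \<Longrightarrow> u < x \<Longrightarrow> x < v \<Longrightarrow> y \<le> v"
  shows "(u, v) \<in> addable a b S"
  using assms by (fastforce simp: addable_def noncrossing_insert crossing_def)

lemma addable_full: "S \<in> full a b \<Longrightarrow> addable a b S = {}"
  using full_no_extension by (fastforce simp: addable_def)

lemma addable_restrict:
  assumes "t \<in> addable a b S" "t \<in> arcs a' b'"
  shows "t \<in> addable a' b' (S \<inter> arcs a' b')"
  using assms by (auto simp: addable_def intro: noncrossing_subset)

text \<open>One arc short of a full family. Cut at \<open>c\<close> as in \<open>fam_split\<close>.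
  If \<open>(c, b)\<close> is present, exactly one of the two parts has the defect and the other is
  full, so the induction hypothesis applies to the defective part. If \<open>(c, b)\<close> is
  absent, it is the missing arc: both parts are full once it is added, and the quadrilateral lies
  directly below \<open>(a, b)\<close>.\<close>

lemma two_addable:
  assumes "S \<in> fam a b" "int (card S) = 2 * (b - a) - 2"
  shows "\<exists>p q r s. p < q \<and> q < r \<and> r < s \<and> addable a b S = {(p, r), (q, s)}"
  using assms
proof (induction "nat (b - a)" arbitrary: a b S rule: less_induct)
  case less
  note * = famD[OF less.prems(1)]
  \<comment> \<open>For \<open>b = a + 1\<close> the assumed cardinality would be 0, but
    \<open>(a, b)\<close> is always a member.\<close>
  have "card S \<noteq> 0" using *(3,6) by auto
  then have ab: "a + 1 < b" using less.prems(2) *(5) by presburger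
  from fam_split[OF less.prems(1) ab] obtain c where c: "a < c" "c < b" "(a, c) \<in> S"
    and f1: "S \<inter> arcs a c \<in> fam a c" and f2: "insert (c, b) (S \<inter> arcs c b) \<in> fam c b"
    and dec: "S = insert (a, b) (S \<inter> arcs a c \<union> S \<inter> arcs c b)" by metis
  define S1 S2 where "S1 = S \<inter> arcs a c" and "S2 = S \<inter> arcs c b"
  note f1 = f1[folded S1_def] and f2 = f2[folded S2_def]
  have cases: "x = a \<and> y = b \<or> a \<le> x \<and> y \<le> c \<and> (x, y) \<in> S1 \<or> c \<le> x \<and> y \<le> b \<and> (x, y) \<in> S2"
    if "(x, y) \<in> S" for x y
  proof -
    have "(x, y) \<in> insert (a, b) (S1 \<union> S2)" using that dec by (simp add: S1_def S2_def)
    then show ?thesis by (auto simp: S1_def S2_def)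
  qed
  have card: "card S = 1 + card S1 + card S2"
    using card_insert_Un_arcs[of S1 a c S2 b] c dec by (simp add: S1_def S2_def)
  have left: "addable a c S1 \<subseteq> addable a b S"
  proof (rule subrelI)
    fix u v assume uv: "(u, v) \<in> addable a c S1"
    note ** = addableD[OF uv]
    show "(u, v) \<in> addable a b S"
    proof (rule addableI[OF *(2)])
      show "(u, v) \<notin> S" using **(1-4) by (simp add: S1_def)
      show "v \<le> y" if "(x, y) \<in> S" "x < u" "u < y" for x y
        using cases[OF that(1)] that(2-) **(1-3) **(5)[of x y] c by linarith
      show "y \<le> v" if "(x, y) \<in> S" "u < x" "x < v" for x y
        using cases[OF that(1)] that(2-) **(1-3) **(6)[of x y] c by linarith
    qed (use ** c in linarith)+
  qed
  have restr1: "(u, v) \<in> addable a c S1" if "(u, v) \<in> addable a b S" "v \<le> c" for u v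
    unfolding S1_def using addableD(1,2)[OF that(1)] that(2) by (intro addable_restrict[OF that(1)]) simp
  have restr2: "(u, v) \<in> addable c b S2" if "(u, v) \<in> addable a b S" "c \<le> u" for u v
    unfolding S2_def using addableD(2,3)[OF that(1)] that(2) by (intro addable_restrict[OF that(1)]) simp
  have straddle: "u = a" if "(u, v) \<in> addable a b S" "u < c" "c < v" for u v
    using addableD(1)[OF that(1)] addableD(5)[OF that(1) c(3)] that(2,3) by linarith
  show ?case
  proof (cases "(c, b) \<in> S")
    case True
    have f2': "S2 \<in> fam c b"
      using f2 True c by (simp add: S2_def insert_absorb)
    have right: "addable c b S2 \<subseteq> addable a b S"
    proof (rule subrelI)
      fix u v assume uv: "(u, v) \<in> addable c b S2"
      note ** = addableD[OF uv]
      show "(u, v) \<in> addable a b S"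
      proof (rule addableI[OF *(2)])
        show "(u, v) \<notin> S" using **(1-4) by (simp add: S2_def)
        show "v \<le> y" if "(x, y) \<in> S" "x < u" "u < y" for x y
          using cases[OF that(1)] that(2-) **(1-3) **(5)[of x y] c by linarith
        show "y \<le> v" if "(x, y) \<in> S" "u < x" "x < v" for x y
          using cases[OF that(1)] that(2-) **(1-3) **(6)[of x y] c by linarith
      qed (use ** c in linarith)+
    qed
    have "(u, v) \<in> addable a c S1 \<union> addable c b S2" if uv: "(u, v) \<in> addable a b S" for u v
    proof -
      \<comment> \<open>An addable arc passing over \<open>c\<close> has to start at
        \<open>a\<close> because of \<open>(a, c)\<close> and to end at \<open>b\<close> because of
        \<open>(c, b)\<close>; but \<open>(a, b)\<close> is already in \<open>S\<close>.\<close>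
      have False if "u < c" "c < v"
      proof -
        have "u = a" using straddle[OF uv that] .
        moreover have "v = b"
          using addableD(3)[OF uv] addableD(6)[OF uv True] that by linarith
        ultimately show False using addableD(4)[OF uv] *(3) by simp
      qed
      then show ?thesis using restr1[OF uv] restr2[OF uv] by force
    qed
    then have eq: "addable a b S = addable a c S1 \<union> addable c b S2"
      using left right by (intro equalityI subrelI) auto
    consider "int (card S1) = 2 * (c - a) - 2" "S2 \<in> full c b"
      | "S1 \<in> full a c" "int (card S2) = 2 * (b - c) - 2"
      using card_fam_le[OF f1] card_fam_le[OF f2'] card less.prems(2) f1 f2'
      by (fastforce simp: full_def)
    then show ?thesis
    proof cases
      case 1
      then show ?thesis using less.hyps[OF _ f1 1(1)] c by (simp add: eq addable_full)
    next
      case 2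
      then show ?thesis using less.hyps[OF _ f2' 2(2)] c by (simp add: eq addable_full)
    qed
  next
    case False
    then have n: "(c, b) \<notin> S2" by (simp add: S2_def)
    have "card (insert (c, b) S2) = Suc (card S2)" using n by (simp add: S2_def)
    then have full1: "S1 \<in> full a c" and full2: "insert (c, b) S2 \<in> full c b"
      using card_fam_le[OF f1] card_fam_le[OF f2] card less.prems(2) f1 f2
      by (simp_all add: full_def)
    have cb: "c + 1 < b"
    proof (rule ccontr)
      assume "\<not> c + 1 < b"
      then have "b = c + 1" using c by simp
      then show False using *(4)[of c] False c by simp
    qed
    \<comment> \<open>\<open>e\<close> is the apex of the triangle over the absent arc
      \<open>(c, b)\<close>. The quadrilateral has corners \<open>a\<close>, \<open>c\<close>,
      \<open>e\<close>, \<open>b\<close>, and its diagonals are \<open>(a, e)\<close> and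
      \<open>(c, b)\<close>.\<close>
    from full_split[OF full2 cb] obtain e where e: "c < e" "e < b"
      "insert (c, b) S2 \<inter> arcs c e \<in> full c e" "insert (c, b) S2 \<inter> arcs e b \<in> full e b"
      and dec2: "insert (c, b) S2 = insert (c, b) (insert (c, b) S2 \<inter> arcs c e \<union> insert (c, b) S2 \<inter> arcs e b)" by metis
    have ce: "(c, e) \<in> S" and eb: "(e, b) \<in> S"
      using famD(3)[of _ c e] famD(3)[of _ e b] e by (auto simp: full_def S2_def)
    have cases2: "x = a \<and> y = b \<or> a \<le> x \<and> y \<le> c \<or> c \<le> x \<and> y \<le> e \<or> e \<le> x \<and> y \<le> b"
      if "(x, y) \<in> S" for x y
    proof -
      have "(x, y) \<in> insert (c, b) S2 \<inter> arcs c e \<union> insert (c, b) S2 \<inter> arcs e b" if "(x, y) \<in> S2"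
        using that dec2 n by auto
      then show ?thesis using cases[OF that] by auto
    qed
    have "(c, b) \<in> addable a b S"
    proof (rule addableI[OF *(2)])
      show "b \<le> y" if "(x, y) \<in> S" "x < c" "c < y" for x y
        using cases[OF that(1)] that by linarith
      show "y \<le> b" if "(x, y) \<in> S" "c < x" "x < b" for x y
        using cases[OF that(1)] that c by linarith
    qed (use c False in auto)
    moreover have "(a, e) \<in> addable a b S"
    proof (rule addableI[OF *(2)])
      show "(a, e) \<notin> S" using cases2[of a e] c e by auto
      show "e \<le> y" if "(x, y) \<in> S" "x < a" "a < y" for x y
        using cases[OF that(1)] that c by linarith
      show "y \<le> e" if "(x, y) \<in> S" "a < x" "x < e" for x y
        using cases2[OF that(1)] that c e by linarith
    qed (use c e in auto)
    moreover have "(u, v) = (c, b) \<or> (u, v) = (a, e)" if uv: "(u, v) \<in> addable a b S" for u v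
    proof -
      note ** = addableD[OF uv]
      consider "v \<le> c" | "c \<le> u" | "u < c" "c < v" by linarith
      then show ?thesis
      proof cases
        case 1
        then show ?thesis using restr1[OF uv] addable_full[OF full1] by simp
      next
        case 2
        then have uv2: "(u, v) \<in> addable c b S2" using restr2[OF uv] by simp
        \<comment> \<open>\<open>(c, b)\<close> encloses everything in the right part, so adding it
          keeps the family noncrossing and the maximality of the completed right part can be
          applied.\<close>
        have "noncrossing (insert (c, b) (insert (u, v) S2))"
          using uv2 by (intro noncrossing_insert_outer[of "insert (u, v) S2"])
            (auto simp: addable_def S2_def)
        then have "(u, v) \<in> insert (c, b) S2"
          using full_no_extension[OF full2, of "(u, v)"] addableD(1-3)[OF uv2]
          by (simp add: insert_commute)
        then show ?thesis using addableD(4)[OF uv2] by simp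
      next
        case 3
        have "u = a" using straddle[OF uv 3] .
        \<comment> \<open>Ending strictly between \<open>c\<close> and \<open>e\<close> would cross
          \<open>(c, e)\<close>, and strictly between \<open>e\<close> and \<open>b\<close> would
          cross \<open>(e, b)\<close>. Only the ends \<open>e\<close> and \<open>b\<close>
          remain.\<close>
        moreover have "e \<le> v" using **(6)[OF ce] 3 by simp
        moreover have "v = b" if "e < v" using **(6)[OF eb] **(3) 3 e that by simp
        moreover have "(u, v) \<noteq> (a, b)" using **(4) *(3) by auto
        ultimately show ?thesis by force
      qed
    qed
    ultimately have "addable a b S = {(a, e), (c, b)}" by (intro equalityI subrelI) auto
    then show ?thesis using c e by blast
  qed
qed

section \<open>Dissections as noncrossing families\<close>

definition long_arcs :: "int \<Rightarrow> (int \<times> int) set" where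
  "long_arcs m = {(x, y). 0 \<le> x \<and> x + 2 \<le> y \<and> y \<le> m}"

definition unit_arcs :: "int \<Rightarrow> (int \<times> int) set" where
  "unit_arcs m = (\<lambda>x. (x, x + 1)) ` {0..<m}"

definition long_families :: "int \<Rightarrow> nat \<Rightarrow> (int \<times> int) set set" where
  "long_families m k = {S. S \<subseteq> long_arcs m \<and> noncrossing S \<and> card S = k}"

lemma long_arcs_iff [simp]: "(x, y) \<in> long_arcs m \<longleftrightarrow> 0 \<le> x \<and> x + 2 \<le> y \<and> y \<le> m"
  by (simp add: long_arcs_def)

lemma unit_arcs_iff [simp]: "(x, y) \<in> unit_arcs m \<longleftrightarrow> 0 \<le> x \<and> y = x + 1 \<and> x < m"
  by (auto simp: unit_arcs_def)

lemma arcs_eq: "arcs 0 m = long_arcs m \<union> unit_arcs m"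
  by auto

lemma long_unit_disjoint: "long_arcs m \<inter> unit_arcs m = {}"
  by auto

lemma finite_long_arcs [simp]: "finite (long_arcs m)" and finite_unit_arcs [simp]: "finite (unit_arcs m)"
  using finite_arcs[of 0 m] by (simp_all add: arcs_eq)

lemma card_unit_arcs: "card (unit_arcs m) = nat m"
  unfolding unit_arcs_def by (subst card_image) (auto simp: inj_on_def)

lemma finite_long_families [simp]: "finite (long_families m k)"
  by (rule finite_subset[of _ "Pow (long_arcs m)"]) (auto simp: long_families_def)

lemma noncrossing_Un_unit_arcs [simp]: "noncrossing (S \<union> unit_arcs m) \<longleftrightarrow> noncrossing S"
  by (auto simp: noncrossing_def crossing_def unit_arcs_def)

lemma card_Un_unit_arcs:
  assumes "S \<subseteq> long_arcs m"
  shows "card (S \<union> unit_arcs m) = card S + nat m"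
proof -
  have "S \<inter> unit_arcs m = {}" using assms long_unit_disjoint by blast
  moreover have "finite S" using finite_subset[OF assms finite_long_arcs] .
  ultimately show ?thesis by (simp add: card_Un_disjoint card_unit_arcs)
qed

lemma Un_unit_arcs_fam:
  assumes "S \<subseteq> long_arcs m" "noncrossing S" "(0, m) \<in> S \<union> unit_arcs m"
  shows "S \<union> unit_arcs m \<in> fam 0 m"
  using assms arcs_eq[of m] by (auto simp: fam_def)

text \<open>Adding the \<open>m\<close> unit arcs turns \<open>m - 1\<close> into the maximum
  \<open>2 * m - 1\<close>. Such a family automatically contains \<open>(0, m)\<close>, for
  otherwise inserting this outermost arc would exceed \<open>card_fam_le\<close>. For
  \<open>m = 1\<close> it is one of the unit arcs.\<close>

lemma card_long_families_max:
  assumes m: "m \<ge> 1"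
  shows "card (long_families m (nat (m - 1))) = card (full 0 m)"
proof -
  have "bij_betw (\<lambda>S. S \<union> unit_arcs m) (long_families m (nat (m - 1))) (full 0 m)"
  proof (rule bij_betw_byWitness[where f' = "\<lambda>F. F - unit_arcs m"])
    show "\<forall>S\<in>long_families m (nat (m - 1)). S \<union> unit_arcs m - unit_arcs m = S"
      using long_unit_disjoint by (fastforce simp: long_families_def)
    show "\<forall>F\<in>full 0 m. F - unit_arcs m \<union> unit_arcs m = F"
      using famD(4) by (fastforce simp: full_def unit_arcs_def)
    show "(\<lambda>S. S \<union> unit_arcs m) ` long_families m (nat (m - 1)) \<subseteq> full 0 m"
    proof clarify
      fix S assume "S \<in> long_families m (nat (m - 1))"
      then have S: "S \<subseteq> long_arcs m" "noncrossing S" "card S = nat (m - 1)"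
        by (auto simp: long_families_def)
      have card: "int (card (S \<union> unit_arcs m)) = 2 * m - 1"
        using card_Un_unit_arcs[OF S(1)] S(3) m by simp
      have "(0, m) \<in> S \<union> unit_arcs m"
      proof (rule ccontr)
        assume n: "(0, m) \<notin> S \<union> unit_arcs m"
        then have "(0, m) \<in> long_arcs m" using m by auto
        moreover have "noncrossing (insert (0, m) S)"
          using noncrossing_insert_outer[OF S(2), of 0 m] S(1) arcs_eq by blast
        ultimately have "insert (0, m) S \<union> unit_arcs m \<in> fam 0 m"
          using S by (intro Un_unit_arcs_fam) auto
        then show False
          using card_fam_le[of "insert (0, m) (S \<union> unit_arcs m)" 0 m] n card
            finite_subset[OF S(1)] by simp
      qed
      then show "S \<union> unit_arcs m \<in> full 0 m"
        using Un_unit_arcs_fam S card by (simp add: full_def)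
    qed
    show "(\<lambda>F. F - unit_arcs m) ` full 0 m \<subseteq> long_families m (nat (m - 1))"
    proof clarify
      fix F assume F: "F \<in> full 0 m"
      then have *: "F \<subseteq> arcs 0 m" "noncrossing F" "unit_arcs m \<subseteq> F" "finite F"
        using famD[of F 0 m] by (auto simp: full_def)
      have "card (F - unit_arcs m) = card F - nat m"
        using * by (subst card_Diff_subset) (auto simp: card_unit_arcs)
      then show "F - unit_arcs m \<in> long_families m (nat (m - 1))"
        using * F arcs_eq[of m]
        by (auto simp: long_families_def full_def intro: noncrossing_subset)
    qed
  qed
  then show ?thesis by (rule bij_betw_same_card)
qed

text \<open>By the same counting argument \<open>(0, m)\<close> lies in every long family of size
  \<open>m - 1\<close>, so removing it is a bijection onto the families of size \<open>m - 2\<close>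
  without it: the triangulations of the \<open>(m + 1)\<close>-gon, given by diagonals only.\<close>

lemma card_long_families_inner:
  assumes m: "m \<ge> 2"
  shows "card {S \<in> long_families m (nat (m - 2)). (0, m) \<notin> S} = card (full 0 m)"
proof -
  have outer: "(0, m) \<in> S" if "S \<in> long_families m (nat (m - 1))" for S
  proof (rule ccontr)
    assume n: "(0, m) \<notin> S"
    have S: "S \<subseteq> long_arcs m" "noncrossing S" "card S = nat (m - 1)"
      using that by (auto simp: long_families_def)
    have "noncrossing (insert (0, m) S)"
      using noncrossing_insert_outer[OF S(2), of 0 m] S(1) arcs_eq by blast
    then have "insert (0, m) S \<union> unit_arcs m \<in> fam 0 m"
      using S m by (intro Un_unit_arcs_fam) auto
    then show False
      using card_fam_le[of "insert (0, m) S \<union> unit_arcs m" 0 m] n S m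
        card_Un_unit_arcs[of "insert (0, m) S" m] finite_subset[OF S(1)] by simp
  qed
  have "bij_betw (insert (0, m)) {S \<in> long_families m (nat (m - 2)). (0, m) \<notin> S}
      (long_families m (nat (m - 1)))"
  proof (rule bij_betw_byWitness[where f' = "\<lambda>S. S - {(0, m)}"])
    show "insert (0, m) ` {S \<in> long_families m (nat (m - 2)). (0, m) \<notin> S} \<subseteq> long_families m (nat (m - 1))"
    proof clarify
      fix S assume "S \<in> long_families m (nat (m - 2))" and n: "(0, m) \<notin> S"
      then have S: "S \<subseteq> long_arcs m" "noncrossing S" "card S = nat (m - 2)"
        by (auto simp: long_families_def)
      have "noncrossing (insert (0, m) S)"
        using noncrossing_insert_outer[OF S(2), of 0 m] S(1) arcs_eq by blast
      then show "insert (0, m) S \<in> long_families m (nat (m - 1))"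
        using S n m finite_subset[OF S(1)] by (auto simp: long_families_def)
    qed
    show "(\<lambda>S. S - {(0, m)}) ` long_families m (nat (m - 1))
        \<subseteq> {S \<in> long_families m (nat (m - 2)). (0, m) \<notin> S}"
    proof clarify
      fix S assume *: "S \<in> long_families m (nat (m - 1))"
      have "card (S - {(0, m)}) = nat (m - 2)"
        using outer[OF *] * finite_subset[of S "long_arcs m"] by (auto simp: long_families_def)
      then show "S - {(0, m)} \<in> long_families m (nat (m - 2)) \<and> (0, m) \<notin> S - {(0, m)}"
        using * by (auto simp: long_families_def intro: noncrossing_subset)
    qed
  qed (use outer in auto)
  then show ?thesis using card_long_families_max[of m] m by (simp add: bij_betw_same_card)
qed

section \<open>From arcs to diagonals of the polygon\<close>

definition edge :: "int \<times> int \<Rightarrow> int set" where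
  "edge t = {fst t, snd t}"

lemma edge_pair [simp]: "edge (x, y) = {x, y}"
  by (simp add: edge_def)

lemma inj_on_edge: "inj_on edge (arcs a b)"
  by (auto simp: inj_on_def doubleton_eq_iff)

lemma crosses_edge:
  assumes "s \<in> arcs a b" "t \<in> arcs a b"
  shows "crosses (edge s) (edge t) \<longleftrightarrow> crossing s t \<or> crossing t s"
proof -
  obtain x y u v where [simp]: "s = (x, y)" "t = (u, v)" by (cases s; cases t) auto
  have "x < y" "u < v" using assms by auto
  then show ?thesis
    by (auto simp: crosses_def crossing_def doubleton_eq_iff)
qed

lemma not_crosses_self: "\<not> crosses d d"
  by (auto simp: crosses_def doubleton_eq_iff)

text \<open>Ordering the endpoints cuts the boundary at the side joining \<open>n - 1\<close> and
  \<open>0\<close>. Cyclic non-adjacency then means a gap of at least 2, except for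
  \<open>(0, n - 1)\<close>, which is that side.\<close>

lemma diagonals_eq: "n \<ge> 3 \<Longrightarrow> diagonals n = edge ` (long_arcs (int n - 1) - {(0, int n - 1)})"
proof (rule antisym)
  assume n: "n \<ge> 3"
  have ordered: "{a, b} \<in> edge ` (long_arcs (int n - 1) - {(0, int n - 1)})"
    if "a < b" "0 \<le> a" "b < int n" "b \<noteq> (a + 1) mod int n" "a \<noteq> (b + 1) mod int n" for a b
  proof (rule image_eqI[of _ _ "(a, b)"])
    have "b \<noteq> a + 1" using that by auto
    moreover have "\<not> (a = 0 \<and> b = int n - 1)" using that by auto
    ultimately show "(a, b) \<in> long_arcs (int n - 1) - {(0, int n - 1)}" using that by auto
  qed simp
  show "diagonals n \<subseteq> edge ` (long_arcs (int n - 1) - {(0, int n - 1)})"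
  proof
    fix d assume "d \<in> diagonals n"
    then obtain a b where d: "d = {a, b}" "0 \<le> a" "a < int n" "0 \<le> b" "b < int n" "a \<noteq> b"
      "b \<noteq> (a + 1) mod int n" "a \<noteq> (b + 1) mod int n"
      unfolding diagonals_def by auto
    then show "d \<in> edge ` (long_arcs (int n - 1) - {(0, int n - 1)})"
      using ordered[of a b] ordered[of b a] by (cases "a < b") (auto simp: insert_commute)
  qed
  show "edge ` (long_arcs (int n - 1) - {(0, int n - 1)}) \<subseteq> diagonals n"
  proof
    fix d assume "d \<in> edge ` (long_arcs (int n - 1) - {(0, int n - 1)})"
    then obtain t where d: "d = edge t" and t: "t \<in> long_arcs (int n - 1) - {(0, int n - 1)}" by blast
    obtain x y where txy: "t = (x, y)" by (cases t)
    have xy: "(x, y) \<in> long_arcs (int n - 1)" "(x, y) \<noteq> (0, int n - 1)"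
      using t txy by auto
    have "y \<noteq> (x + 1) mod int n" using xy by auto
    moreover have "x \<noteq> (y + 1) mod int n"
      using xy by (cases "y = int n - 1") auto
    ultimately show "d \<in> diagonals n"
      using xy unfolding diagonals_def d txy by fastforce
  qed
qed

lemma noncrossing_edges:
  assumes "S \<subseteq> arcs a b"
  shows "(\<forall>d\<in>edge ` S. \<forall>e\<in>edge ` S. \<not> crosses d e) \<longleftrightarrow> noncrossing S"
proof -
  have "crosses (edge s) (edge t) \<longleftrightarrow> crossing s t \<or> crossing t s" if "s \<in> S" "t \<in> S" for s t
    using crosses_edge that assms by blast
  then show ?thesis unfolding noncrossing_def by blast
qed

lemma dissections_eq:
  assumes n: "n \<ge> 3"
  shows "dissections n k =
    image edge ` {S \<in> long_families (int n - 1) k. (0, int n - 1) \<notin> S}" (is "_ = image edge ` ?X")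
proof -
  let ?L = "long_arcs (int n - 1)"
  have *: "edge ` S \<in> dissections n k \<longleftrightarrow> S \<in> ?X"
    if "S \<subseteq> ?L - {(0, int n - 1)}" for S
  proof -
    have sub: "S \<subseteq> arcs 0 (int n - 1)" using that arcs_eq by blast
    have "card (edge ` S) = card S"
      using inj_on_edge sub by (intro card_image) (blast intro: inj_on_subset)
    moreover have "edge ` S \<subseteq> diagonals n" using that diagonals_eq[OF n] by blast
    ultimately show ?thesis
      using that noncrossing_edges[OF sub] by (auto simp: dissections_def long_families_def)
  qed
  show ?thesis
  proof (intro equalityI subsetI)
    fix D assume D: "D \<in> dissections n k"
    then have "D \<subseteq> edge ` (?L - {(0, int n - 1)})"
      using diagonals_eq[OF n] by (auto simp: dissections_def)
    then obtain S where "S \<subseteq> ?L - {(0, int n - 1)}" "D = edge ` S"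
      by (meson subset_imageE)
    then show "D \<in> image edge ` ?X" using * D by blast
  next
    fix D assume "D \<in> image edge ` ?X"
    then obtain S where "S \<in> ?X" "D = edge ` S" by blast
    moreover from this have "S \<subseteq> ?L - {(0, int n - 1)}" by (auto simp: long_families_def)
    ultimately show "D \<in> dissections n k" using * by blast
  qed
qed

lemma inj_on_image_edge: "inj_on (image edge) (Pow (arcs a b))"
  using inj_on_edge by (rule inj_on_image_Pow)

lemma finite_dissections [simp]: "n \<ge> 3 \<Longrightarrow> finite (dissections n k)"
  by (simp add: dissections_eq)

lemma card_triangulations:
  assumes n: "n \<ge> 3"
  shows "real (card (dissections n (n - 3))) = catalan (real n - 2)"
proof -
  let ?X = "{S \<in> long_families (int n - 1) (n - 3). (0, int n - 1) \<notin> S}"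
  have "?X \<subseteq> Pow (arcs 0 (int n - 1))" using arcs_eq by (auto simp: long_families_def)
  from card_image[OF inj_on_subset[OF inj_on_image_edge this]]
  have "card (dissections n (n - 3)) = card ?X" by (simp only: dissections_eq[OF n])
  also have "\<dots> = card (full 0 (int n - 1))"
  proof -
    have "nat (int n - 1 - 2) = n - 3" by simp
    then show ?thesis using card_long_families_inner[of "int n - 1"] n by simp
  qed
  finally show ?thesis using card_full[of 0 "int n - 1"] n by simp
qed

section \<open>Diagonals addable to a dissection, and the number of almost-triangulations\<close>

definition completions :: "nat \<Rightarrow> int set set \<Rightarrow> int set set" where
  "completions n D = {e \<in> diagonals n - D. \<forall>d\<in>D. \<not> crosses d e}"

text \<open>The sides of the polygon are joined to \<open>S\<close> to form a member of
  \<open>fam\<close>. They cross no arc of the interval, so the noncrossing conditions agree, and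
  being present already they are no candidates for addition.\<close>

lemma completions_eq_addable:
  assumes n: "n \<ge> 3" and S: "S \<in> long_families (int n - 1) k" "(0, int n - 1) \<notin> S"
  shows "completions n (edge ` S) =
    edge ` addable 0 (int n - 1) (insert (0, int n - 1) S \<union> unit_arcs (int n - 1))"
proof -
  define N where "N = int n - 1"
  define F where "F = insert (0, N) S \<union> unit_arcs N"
  have S': "S \<subseteq> long_arcs N" "noncrossing S" using S by (auto simp: long_families_def N_def)
  then have Sa: "S \<subseteq> arcs 0 N" using arcs_eq by blast
  have "noncrossing (insert t F) \<longleftrightarrow> (\<forall>s\<in>S. \<not> crosses (edge s) (edge t))" if t: "t \<in> arcs 0 N" for t
  proof -
    have "noncrossing (insert t F) \<longleftrightarrow> noncrossing (insert (0, N) (insert t S))"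
    proof -
      have "insert t F = insert (0, N) (insert t S) \<union> unit_arcs N" by (auto simp: F_def)
      then show ?thesis by (simp only: noncrossing_Un_unit_arcs)
    qed
    also have "\<dots> \<longleftrightarrow> noncrossing (insert t S)"
      using noncrossing_insert_outer[of "insert t S" 0 N] Sa t
      by (auto intro: noncrossing_subset)
    also have "\<dots> \<longleftrightarrow> (\<forall>s\<in>S. \<not> crosses (edge s) (edge t))"
      unfolding noncrossing_insert using S' Sa t crosses_edge by blast
    finally show ?thesis .
  qed
  moreover have "arcs 0 N - F = long_arcs N - {(0, N)} - S"
    using arcs_eq[of N] long_unit_disjoint[of N] by (auto simp: F_def)
  moreover have "long_arcs N - {(0, N)} - S \<subseteq> arcs 0 N" using arcs_eq by blast
  ultimately have A: "addable 0 N F = {t \<in> long_arcs N - {(0, N)} - S. \<forall>s\<in>S. \<not> crosses (edge s) (edge t)}"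
    unfolding addable_def by blast
  have nS: "edge t \<notin> edge ` S" if "t \<in> long_arcs N - {(0, N)} - S" for t
    using inj_on_image_mem_iff[OF inj_on_edge _ Sa] that arcs_eq[of N] by blast
  have C: "completions n (edge ` S) =
      {e \<in> edge ` (long_arcs N - {(0, N)}) - edge ` S. \<forall>s\<in>S. \<not> crosses (edge s) e}"
    unfolding completions_def diagonals_eq[OF n] N_def[symmetric] by simp
  have "completions n (edge ` S) = edge ` addable 0 N F"
  proof (intro equalityI subsetI)
    fix e assume "e \<in> completions n (edge ` S)"
    then obtain t where "e = edge t" "t \<in> long_arcs N - {(0, N)}" "edge t \<notin> edge ` S"
      "\<forall>s\<in>S. \<not> crosses (edge s) (edge t)" unfolding C by blast
    moreover from this have "t \<notin> S" by blast
    ultimately show "e \<in> edge ` addable 0 N F" unfolding A by blast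
  next
    fix e assume "e \<in> edge ` addable 0 N F"
    then obtain t where "e = edge t" "t \<in> long_arcs N - {(0, N)} - S"
      "\<forall>s\<in>S. \<not> crosses (edge s) (edge t)" unfolding A by blast
    then show "e \<in> completions n (edge ` S)" unfolding C using nS[of t] by blast
  qed
  then show ?thesis by (simp add: N_def F_def)
qed

lemma completions_pair:
  assumes n: "n \<ge> 4" and D: "D \<in> dissections n (n - 4)"
  obtains p q r s where "0 \<le> p" "p < q" "q < r" "r < s" "s < int n"
    "completions n D = {{p, r}, {q, s}}"
proof -
  have n3: "n \<ge> 3" using n by simp
  define N where "N = int n - 1"
  obtain S where S: "S \<in> long_families N (n - 4)" "(0, N) \<notin> S" "D = edge ` S"
    using D unfolding dissections_eq[OF n3] N_def by blast
  define F where "F = insert (0, N) S \<union> unit_arcs N"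
  have S': "S \<subseteq> long_arcs N" "noncrossing S" "card S = n - 4"
    using S by (auto simp: long_families_def)
  have sub: "insert (0, N) S \<subseteq> long_arcs N" using S' n by (auto simp: N_def)
  have "noncrossing (insert (0, N) S)"
    using noncrossing_insert_outer[OF S'(2), of 0 N] S'(1) arcs_eq by blast
  then have fam: "F \<in> fam 0 N" unfolding F_def using sub by (intro Un_unit_arcs_fam) auto
  \<comment> \<open>\<open>n - 4\<close> diagonals, the side \<open>(0, n - 1)\<close> and
    \<open>n - 1\<close> unit arcs: one less than the maximum over an interval of length
    \<open>n - 1\<close>.\<close>
  have "int (card F) = 2 * (N - 0) - 2"
    using card_Un_unit_arcs[OF sub] S' S(2) finite_subset[OF S'(1)] n by (simp add: F_def N_def)
  from two_addable[OF fam this] obtain p q r s where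
    *: "p < q" "q < r" "r < s" "addable 0 N F = {(p, r), (q, s)}" by blast
  have "(p, r) \<in> addable 0 N F" "(q, s) \<in> addable 0 N F" using * by auto
  from addableD(1)[OF this(1)] addableD(3)[OF this(2)] have "0 \<le> p" "s < int n"
    by (auto simp: N_def)
  moreover have "completions n D = {{p, r}, {q, s}}"
    using completions_eq_addable[OF n3, of S "n - 4"] S * by (simp add: N_def F_def)
  ultimately show ?thesis using that * by blast
qed

lemma card_completions:
  assumes n: "n \<ge> 4" and D: "D \<in> dissections n (n - 4)"
  shows "card (completions n D) = 2"
proof -
  obtain p q r s where "p < q" "q < r" "r < s" "completions n D = {{p, r}, {q, s}}"
    using completions_pair[OF assms] by metis
  moreover from this have "{p, r} \<noteq> {q, s}" by (auto simp: doubleton_eq_iff)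
  ultimately show ?thesis by simp
qed

lemma finite_diagonals [simp]: "n \<ge> 3 \<Longrightarrow> finite (diagonals n)"
  by (simp add: diagonals_eq)

lemma finite_dissection: "n \<ge> 3 \<Longrightarrow> D \<in> dissections n k \<Longrightarrow> finite D"
  using finite_subset[OF _ finite_diagonals] by (auto simp: dissections_def)

lemma card_almost_triangulations:
  assumes n: "n \<ge> 4"
  shows "2 * real (card (dissections n (n - 4))) = (real n - 3) * catalan (real n - 2)"
proof -
  have n3: "n \<ge> 3" using n by simp
  let ?A = "SIGMA D:dissections n (n - 4). completions n D"
  let ?B = "SIGMA T:dissections n (n - 3). T"
  \<comment> \<open>A pair \<open>(D, e)\<close> amounts to a triangulation with a marked diagonal.
    Each \<open>D\<close> occurs in two pairs and each triangulation in
    \<open>n - 3\<close>.\<close>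
  have "bij_betw (\<lambda>(D, e). (insert e D, e)) ?A ?B"
  proof (rule bij_betw_byWitness[where f' = "\<lambda>(T, e). (T - {e}, e)"])
    show "(\<lambda>(D, e). (insert e D, e)) ` ?A \<subseteq> ?B"
    proof clarify
      fix D e assume *: "D \<in> dissections n (n - 4)" "e \<in> completions n D"
      then have "card (insert e D) = n - 3"
        using finite_dissection[OF n3 *(1)] n by (auto simp: dissections_def completions_def)
      then show "insert e D \<in> dissections n (n - 3) \<and> e \<in> insert e D"
        using * crosses_sym not_crosses_self by (auto simp: dissections_def completions_def)
    qed
    show "(\<lambda>(T, e). (T - {e}, e)) ` ?B \<subseteq> ?A"
    proof clarify
      fix T e assume *: "T \<in> dissections n (n - 3)" "e \<in> T"
      then have "card (T - {e}) = n - 4"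
        using finite_dissection[OF n3 *(1)] n by (auto simp: dissections_def)
      then show "T - {e} \<in> dissections n (n - 4) \<and> e \<in> completions n (T - {e})"
        using * by (auto simp: dissections_def completions_def)
    qed
  qed (auto simp: completions_def)
  then have "card ?A = card ?B" by (rule bij_betw_same_card)
  moreover have "card ?A = (\<Sum>D\<in>dissections n (n - 4). card (completions n D))"
    using n3 by (intro card_SigmaI) (auto simp: completions_def)
  moreover have "card ?B = (\<Sum>T\<in>dissections n (n - 3). card T)"
    using n3 finite_dissection[OF n3] by (intro card_SigmaI) auto
  moreover have "(\<Sum>T\<in>dissections n (n - 3). card T) = (n - 3) * card (dissections n (n - 3))"
    by (simp add: dissections_def)
  ultimately have "2 * card (dissections n (n - 4)) = (n - 3) * card (dissections n (n - 3))"
    using card_completions[OF n] by simp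
  then have "2 * real (card (dissections n (n - 4))) = real (n - 3) * real (card (dissections n (n - 3)))"
    by (metis of_nat_mult of_nat_numeral)
  then show ?thesis using card_triangulations[OF n3] n by simp
qed

section \<open>Rotations and sectors\<close>

text \<open>Here \<open>g\<close> is any integer, not a residue, so that the inverse is the turn by
  \<open>- g\<close> and multiples \<open>j * m\<close> can be used freely.\<close>

abbreviation turn :: "nat \<Rightarrow> int \<Rightarrow> int set \<Rightarrow> int set" where
  "turn n g \<equiv> image (rotate_vertex n g)"

lemma rotate_vertex_cong: "g mod int n = h mod int n \<Longrightarrow> rotate_vertex n g = rotate_vertex n h"
  unfolding rotate_vertex_def by (metis mod_add_right_eq)

lemma turn_turn: "turn n g (turn n h d) = turn n (g + h) d"
proof -
  have "rotate_vertex n ((g + h) mod int n) = rotate_vertex n (g + h)"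
    by (rule rotate_vertex_cong) simp
  then show ?thesis by (simp add: image_image rotate_vertex_add)
qed

lemma turn_0: "d \<subseteq> {0..<int n} \<Longrightarrow> turn n 0 d = d"
  by (force simp: subset_iff rotate_vertex_0)

lemma turn_inverse: "d \<subseteq> {0..<int n} \<Longrightarrow> turn n (- g) (turn n g d) = d"
  by (simp add: turn_turn turn_0)

lemma turn_subset: "n > 0 \<Longrightarrow> turn n g d \<subseteq> {0..<int n}"
  using rotate_vertex_in by blast

lemma crosses_turn:
  assumes n: "n > 0" and d: "d \<subseteq> {0..<int n}" and e: "e \<subseteq> {0..<int n}"
  shows "crosses (turn n g d) (turn n g e) \<longleftrightarrow> crosses d e"
proof -
  have imp: "crosses (turn n h x) (turn n h y)"
    if "crosses x y" "x \<subseteq> {0..<int n}" "y \<subseteq> {0..<int n}" for h x y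
    using crosses_rotate[OF that(2,3) _ that(1), of "h mod int n"] n
      rotate_vertex_cong[of "h mod int n" n h] by simp
  show ?thesis
    using imp[of d e g] imp[of "turn n g d" "turn n g e" "- g"] d e
      turn_subset[OF n, of g] turn_inverse by metis
qed

lemma turn_dissection:
  assumes n: "n > 0" and D: "D \<in> dissections n k"
  shows "turn n g ` D \<in> dissections n k"
  using rotate_dissection[OF n _ D, of "g mod int n"] n
    rotate_vertex_cong[of "g mod int n" n g] by simp

lemma turn_set_inverse: "D \<subseteq> diagonals n \<Longrightarrow> turn n (- g) ` turn n g ` D = D"
proof -
  assume D: "D \<subseteq> diagonals n"
  have "turn n (- g) (turn n g d) = d" if "d \<in> D" for d
    using turn_inverse[OF diagonals_subset[OF subsetD[OF D that]]] .
  then have "(\<lambda>d. turn n (- g) (turn n g d)) ` D = (\<lambda>d. d) ` D" by (intro image_cong) auto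
  then show ?thesis by (subst image_image) simp
qed

text \<open>One inclusion holds for every rotation; applying it to the turn by \<open>- g\<close>
  gives the other.\<close>

lemma completions_turn:
  assumes n: "n > 0" and D: "D \<subseteq> diagonals n"
  shows "completions n (turn n g ` D) = turn n g ` completions n D"
proof -
  have sub: "turn n h ` completions n E \<subseteq> completions n (turn n h ` E)"
    if E: "E \<subseteq> diagonals n" for h E
  proof clarify
    fix e assume e: "e \<in> completions n E"
    then have ed: "e \<in> diagonals n" "e \<notin> E" by (auto simp: completions_def)
    have "turn n h e \<notin> turn n h ` E"
    proof
      assume "turn n h e \<in> turn n h ` E"
      then obtain d where "d \<in> E" "turn n h e = turn n h d" by blast
      then show False
        using turn_inverse[OF diagonals_subset, of d n h] turn_inverse[OF diagonals_subset, of e n h] E ed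
        by auto
    qed
    moreover have "\<not> crosses (turn n h d) (turn n h e)" if "d \<in> E" for d
      using crosses_turn[OF n diagonals_subset diagonals_subset, of d e h] that E ed e
      by (auto simp: completions_def)
    ultimately show "turn n h e \<in> completions n (turn n h ` E)"
      using rotate_diagonal[OF n ed(1)] by (auto simp: completions_def)
  qed
  have "turn n g ` D \<subseteq> diagonals n" using rotate_diagonal[OF n] D by blast
  from sub[OF this, of "- g"]
  have "turn n (- g) ` completions n (turn n g ` D) \<subseteq> completions n D"
    using turn_set_inverse[OF D] by simp
  then have "turn n g ` turn n (- g) ` completions n (turn n g ` D) \<subseteq> turn n g ` completions n D"
    by (rule image_mono)
  moreover have "turn n g ` turn n (- g) ` completions n (turn n g ` D) = completions n (turn n g ` D)"
    using turn_set_inverse[of "completions n (turn n g ` D)" n "- g"] by (auto simp: completions_def)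
  ultimately show ?thesis using sub[OF D, of g] by simp
qed

text \<open>The boundary is cut into \<open>d\<close> sectors of \<open>m\<close> consecutive sides
  each. \<open>arcs 0 m\<close> lives over the first sector, and \<open>turn n (j * m)\<close>
  carries it to sector \<open>j\<close>. The instances used are \<open>d = 2\<close> for the half
  turn and \<open>d = 4\<close> for the quarter turn.\<close>

locale sectors =
  fixes n d :: nat and m :: int
  assumes n_eq: "int n = int d * m" and m_pos: "m \<ge> 1" and d_ge: "d \<ge> 2"
begin

lemma m_less: "m < int n"
  using n_eq m_pos d_ge mult_right_mono[of 2 "int d" m] by simp

lemma n_pos: "n > 0"
  using m_less m_pos by simp

lemma edge_subset: "t \<in> arcs 0 m \<Longrightarrow> edge t \<subseteq> {0..<int n}"
  using m_less by (cases t) auto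

lemma turn_mod: "turn n (j * m) = turn n ((j mod int d) * m)"
proof -
  have "(j * m) mod int n = (j mod int d) * m"
    using m_pos by (simp add: n_eq mult_mod_left)
  moreover have "\<dots> mod int n = (j mod int d) * m"
    using m_pos by (simp add: n_eq flip: mult_mod_left)
  ultimately show ?thesis using rotate_vertex_cong by metis
qed

text \<open>Wrap-around happens only at the far end of the last sector, where
  \<open>m + (d - 1) * m = n\<close> becomes vertex 0.\<close>

lemma turn_sector:
  assumes "0 \<le> x" "x < y" "y \<le> m" "0 \<le> j" "j < int d"
  shows "turn n (j * m) {x, y} =
    {x + j * m, if j = int d - 1 \<and> y = m then 0 else y + j * m}"
proof -
  have jm: "j * m \<le> (int d - 1) * m" using assms m_pos by (intro mult_right_mono) auto
  then have lt: "x + j * m < int n" "y + j * m \<le> int n" "0 \<le> j * m"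
    using assms m_pos by (auto simp: n_eq algebra_simps)
  have "(x + j * m) mod int n = x + j * m" using lt assms by (intro mod_pos_pos_trivial) auto
  moreover have "(y + j * m) mod int n = (if j = int d - 1 \<and> y = m then 0 else y + j * m)"
  proof (cases "j = int d - 1 \<and> y = m")
    case True
    then have j: "j = int d - 1" and y: "y = m" by auto
    have "y + j * m = int n" unfolding j y n_eq by (simp add: algebra_simps)
    then show ?thesis using True by simp
  next
    case False
    have "y + j * m \<noteq> int n"
    proof (cases "j = int d - 1")
      case True
      have "y + j * m = int n + (y - m)" unfolding True n_eq by (simp add: algebra_simps)
      then show ?thesis using False True by simp
    next
      case j: False
      then have "j * m \<le> (int d - 2) * m" using assms m_pos by (intro mult_right_mono) auto
      moreover have "(int d - 2) * m = int n - 2 * m" by (simp add: n_eq algebra_simps)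
      ultimately show ?thesis using assms m_pos by simp
    qed
    then show ?thesis using lt False assms by auto
  qed
  ultimately show ?thesis by (simp only: image_insert image_empty rotate_vertex_def)
qed

lemma turn_sector_subset:
  assumes t: "t \<in> arcs 0 m" and j: "0 < j" "j < int d"
  shows "turn n (j * m) (edge t) \<subseteq> insert 0 {m..}"
proof -
  obtain x y where t': "t = (x, y)" by (cases t)
  have xy: "0 \<le> x" "x < y" "y \<le> m" using t by (auto simp: t')
  have "m \<le> j * m" using j m_pos by simp
  then have "m \<le> x + j * m" "m \<le> y + j * m" using xy by linarith+
  moreover have "turn n (j * m) {x, y} \<subseteq> {x + j * m, 0, y + j * m}"
    using turn_sector[OF xy, of j] j by simp
  ultimately show ?thesis unfolding t' edge_pair by auto
qed

text \<open>A chord over another sector has no endpoint strictly between 0 and \<open>m\<close>, so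
  its endpoints cannot alternate with those of a chord within \<open>0, \<dots>, m\<close>.\<close>

lemma other_sector_not_crosses:
  assumes s: "s \<in> arcs 0 m" and t: "t \<in> arcs 0 m" and j: "0 < j" "j < int d"
  shows "\<not> crosses (turn n (j * m) (edge s)) (edge t)"
proof
  assume "crosses (turn n (j * m) (edge s)) (edge t)"
  then obtain p q r u where "p < q" "q < r" "r < u"
    "turn n (j * m) (edge s) = {p, r} \<and> edge t = {q, u} \<or> turn n (j * m) (edge s) = {q, u} \<and> edge t = {p, r}"
    unfolding crosses_def by blast
  moreover have "edge t \<subseteq> {0..m}" using t by (cases t) auto
  ultimately show False using turn_sector_subset[OF s j] by auto
qed

text \<open>Two sectors can share a chord only if they have both end vertices in common, which
  happens for \<open>d = 2\<close> and the diameter \<open>(0, m)\<close>. This is the source of all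
  side conditions on \<open>d = 2\<close>.\<close>

lemma other_sector_eq:
  assumes s: "s \<in> arcs 0 m" and t: "t \<in> arcs 0 m" and j: "0 < j" "j < int d"
    and eq: "turn n (j * m) (edge s) = edge t"
  shows "d = 2 \<and> t = (0, m)"
proof -
  obtain x y u v where s': "s = (x, y)" and t': "t = (u, v)" by (cases s; cases t)
  have "{u, v} \<subseteq> insert 0 {m..}" using turn_sector_subset[OF s j] eq by (simp add: t')
  then have uv: "u = 0" "v = m" using t by (auto simp: t')
  have e: "{x + j * m, if j = int d - 1 \<and> y = m then 0 else y + j * m} = {0, m}"
    using turn_sector[of x y j] s j eq by (simp add: s' t' uv)
  have "m \<le> j * m" using j m_pos by simp
  moreover have "0 \<le> x" "x < y" using s by (auto simp: s')
  ultimately have "x + j * m \<noteq> 0" "y + j * m \<noteq> 0" "m \<le> x + j * m" using m_pos by linarith+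
  then have "x + j * m = m" "j = int d - 1"
    using e by (auto simp: doubleton_eq_iff split: if_splits)
  moreover from this have "j * m = m" using \<open>m \<le> j * m\<close> \<open>0 \<le> x\<close> by linarith
  ultimately have "d = 2" using m_pos by simp
  then show ?thesis by (simp add: t' uv)
qed

definition sectored :: "int set set \<Rightarrow> bool" where
  "sectored D \<longleftrightarrow> (\<forall>e\<in>D. \<exists>j. \<exists>t\<in>arcs 0 m. e = turn n (j * m) (edge t))"

text \<open>\<open>j\<close> ranges over all integers, so invariance under \<open>turn n m\<close>
  is an index shift; by \<open>turn_mod\<close> only \<open>d\<close> different copies
  arise.\<close>

definition spread :: "(int \<times> int) set \<Rightarrow> int set set" where
  "spread S = {turn n (j * m) (edge t) |j t. t \<in> S}"

text \<open>Turning back by \<open>i * m\<close> reduces the comparison of two arbitrary sectors to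
  that of some sector with the first one.\<close>

lemma turn_shift:
  assumes "s \<in> arcs 0 m" "t \<in> arcs 0 m"
  shows "turn n (j * m) (edge s) = turn n (i * m) (edge t) \<longleftrightarrow>
      turn n ((j - i) mod int d * m) (edge s) = edge t"
    and "crosses (turn n (j * m) (edge s)) (turn n (i * m) (edge t)) \<longleftrightarrow>
      crosses (turn n ((j - i) mod int d * m) (edge s)) (edge t)"
proof -
  let ?s = "turn n ((j - i) mod int d * m) (edge s)"
  have *: "turn n (j * m) (edge s) = turn n (i * m) ?s"
    unfolding turn_mod[of "j - i", symmetric] turn_turn by (simp add: algebra_simps)
  have sub: "?s \<subseteq> {0..<int n}" "edge t \<subseteq> {0..<int n}"
    using turn_subset[OF n_pos] edge_subset assms by auto
  show "turn n (j * m) (edge s) = turn n (i * m) (edge t) \<longleftrightarrow> ?s = edge t"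
    unfolding * using turn_inverse[OF sub(1), of "i * m"] turn_inverse[OF sub(2), of "i * m"] by metis
  show "crosses (turn n (j * m) (edge s)) (turn n (i * m) (edge t)) \<longleftrightarrow> crosses ?s (edge t)"
    unfolding * by (rule crosses_turn[OF n_pos sub])
qed

lemma spread_invariant: "turn n m ` spread S = spread S"
proof (intro equalityI subsetI)
  fix e assume "e \<in> turn n m ` spread S"
  then obtain j t where "e = turn n m (turn n (j * m) (edge t))" "t \<in> S"
    by (auto simp: spread_def)
  then have "e = turn n ((j + 1) * m) (edge t)" by (simp add: turn_turn algebra_simps)
  then show "e \<in> spread S" using \<open>t \<in> S\<close> unfolding spread_def by blast
next
  fix e assume "e \<in> spread S"
  then obtain j t where *: "e = turn n (j * m) (edge t)" "t \<in> S" by (auto simp: spread_def)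
  then have "e = turn n m (turn n ((j - 1) * m) (edge t))" by (simp add: turn_turn algebra_simps)
  moreover have "turn n ((j - 1) * m) (edge t) \<in> spread S" using * unfolding spread_def by blast
  ultimately show "e \<in> turn n m ` spread S" by blast
qed

lemma card_spread:
  assumes S: "S \<subseteq> arcs 0 m" and nd: "d = 2 \<Longrightarrow> (0, m) \<notin> S"
  shows "card (spread S) = d * card S"
proof -
  let ?f = "\<lambda>(j, t). turn n (j * m) (edge t)"
  have "spread S = ?f ` ({0..<int d} \<times> S)"
  proof (intro equalityI subsetI)
    fix e assume "e \<in> spread S"
    then obtain j t where "e = turn n (j * m) (edge t)" "t \<in> S" by (auto simp: spread_def)
    then have "e = ?f (j mod int d, t)" "(j mod int d, t) \<in> {0..<int d} \<times> S"
      using turn_mod[of j] d_ge by auto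
    then show "e \<in> ?f ` ({0..<int d} \<times> S)" by blast
  next
    fix e assume "e \<in> ?f ` ({0..<int d} \<times> S)"
    then obtain P where P: "P \<in> {0..<int d} \<times> S" "e = ?f P" by blast
    obtain j t where jt: "P = (j, t)" by (cases P)
    have "e = turn n (j * m) (edge t)" "t \<in> S" using P by (simp_all add: jt)
    then show "e \<in> spread S" unfolding spread_def by blast
  qed
  moreover have "inj_on ?f ({0..<int d} \<times> S)"
  proof (rule inj_onI)
    fix P Q assume PQ: "P \<in> {0..<int d} \<times> S" "Q \<in> {0..<int d} \<times> S" "?f P = ?f Q"
    obtain j s i t where P: "P = (j, s)" and Q: "Q = (i, t)" by (cases P; cases Q) auto
    have st: "s \<in> S" "t \<in> S" "s \<in> arcs 0 m" "t \<in> arcs 0 m"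
      and ji: "0 \<le> j" "j < int d" "0 \<le> i" "i < int d" using PQ S by (auto simp: P Q)
    have eq: "turn n ((j - i) mod int d * m) (edge s) = edge t"
      using PQ(3) turn_shift(1)[OF st(3,4), of j i] by (simp add: P Q)
    show "P = Q"
    proof (cases "(j - i) mod int d = 0")
      case True
      have "j = i" using mod_eq_dvd_iff[of j "int d" i] True ji by auto
      moreover have "edge s = edge t" using eq True turn_0[OF edge_subset[OF st(3)]] by simp
      ultimately show ?thesis using inj_on_edge st by (auto simp: P Q inj_on_def)
    next
      case False
      moreover have "0 \<le> (j - i) mod int d" "(j - i) mod int d < int d" using d_ge by auto
      ultimately show ?thesis using other_sector_eq[OF st(3,4) _ _ eq] nd st(2) by auto
    qed
  qed
  ultimately show ?thesis by (simp add: card_image card_cartesian_product)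
qed

lemma spread_mem_iff:
  assumes S: "S \<subseteq> arcs 0 m" and t: "t \<in> arcs 0 m" and nd: "d = 2 \<Longrightarrow> (0, m) \<notin> S"
  shows "edge t \<in> spread S \<longleftrightarrow> t \<in> S"
proof
  assume "t \<in> S"
  moreover have "edge t = turn n (0 * m) (edge t)" using turn_0[OF edge_subset[OF t]] by simp
  ultimately show "edge t \<in> spread S" unfolding spread_def by blast
next
  assume "edge t \<in> spread S"
  then obtain j s where s: "s \<in> S" and "turn n (j * m) (edge s) = edge t"
    by (auto simp: spread_def)
  then have eq: "turn n (0 * m) (edge t) = turn n (j * m) (edge s)"
    using turn_0[OF edge_subset[OF t]] by simp
  have sa: "s \<in> arcs 0 m" using s S by blast
  have eq': "turn n ((0 - j) mod int d * m) (edge t) = edge s"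
    using eq turn_shift(1)[OF t sa, of 0 j] by blast
  show "t \<in> S"
  proof (cases "(0 - j) mod int d = 0")
    case True
    then have "edge t = edge s" using eq' turn_0[OF edge_subset[OF t]] by simp
    then show ?thesis using inj_on_edge t sa s by (metis inj_onD)
  next
    case False
    moreover have "0 \<le> (0 - j) mod int d" "(0 - j) mod int d < int d" using d_ge by auto
    ultimately show ?thesis using other_sector_eq[OF t sa _ _ eq'] nd s by auto
  qed
qed

lemma spread_dissection:
  assumes S: "S \<in> long_families m k" and nd: "d = 2 \<Longrightarrow> (0, m) \<notin> S"
  shows "spread S \<in> dissections n (d * k)"
proof -
  have S': "S \<subseteq> long_arcs m" "noncrossing S" "card S = k" using S by (auto simp: long_families_def)
  then have Sa: "S \<subseteq> arcs 0 m" using arcs_eq by blast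
  have "spread S \<subseteq> diagonals n"
  proof
    fix e assume "e \<in> spread S"
    then obtain j t where e: "e = turn n (j * m) (edge t)" "t \<in> S" by (auto simp: spread_def)
    obtain x y where t: "t = (x, y)" by (cases t)
    have xy: "0 \<le> x" "x + 2 \<le> y" "y \<le> m" using e(2) S'(1) by (auto simp: t)
    have "2 * m \<le> int n" using n_eq d_ge m_pos by simp
    then have "t \<in> long_arcs (int n - 1) - {(0, int n - 1)}" "n \<ge> 3" using xy by (auto simp: t)
    then have "edge t \<in> diagonals n" using diagonals_eq by blast
    then show "e \<in> diagonals n" unfolding e(1) by (rule rotate_diagonal[OF n_pos])
  qed
  moreover have "\<not> crosses e f" if ef: "e \<in> spread S" "f \<in> spread S" for e f
  proof -
    obtain j s i t where e: "e = turn n (j * m) (edge s)" "s \<in> S"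
      and f: "f = turn n (i * m) (edge t)" "t \<in> S" using ef unfolding spread_def by blast
    have st: "s \<in> arcs 0 m" "t \<in> arcs 0 m" using e f Sa by auto
    have "\<not> crosses (turn n ((j - i) mod int d * m) (edge s)) (edge t)"
    proof (cases "(j - i) mod int d = 0")
      case True
      have "\<not> crosses (edge s) (edge t)"
        using crosses_edge[OF st] S'(2) e(2) f(2) by (auto simp: noncrossing_def)
      then show ?thesis using True turn_0[OF edge_subset[OF st(1)]] by simp
    next
      case False
      moreover have "0 \<le> (j - i) mod int d" "(j - i) mod int d < int d" using d_ge by auto
      ultimately show ?thesis by (intro other_sector_not_crosses[OF st]) auto
    qed
    then show ?thesis unfolding e f using turn_shift(2)[OF st] by blast
  qed
  ultimately show ?thesis
    using card_spread[OF Sa nd] S'(3) by (simp add: dissections_def)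
qed

text \<open>An invariant dissection made of sector chords is determined by its part over the first
  sector: \<open>spread\<close> and restriction to that sector are mutually inverse. For
  \<open>d = 2\<close> the diameter is excluded on both sides, since the half turn maps it to itself
  and its copies would not be distinct.\<close>

lemma card_sectored:
  "card {D \<in> dissections n (d * k). turn n m ` D = D \<and> sectored D \<and> (d = 2 \<longrightarrow> {0, m} \<notin> D)} =
   card {S \<in> long_families m k. d = 2 \<longrightarrow> (0, m) \<notin> S}" (is "card ?X = card ?Y")
proof -
  let ?r = "\<lambda>D. {t \<in> long_arcs m. edge t \<in> D}"
  have spread_r: "spread (?r D) = D" if D: "D \<in> ?X" for D
  proof -
    have inv: "turn n m ` D = D" and sec: "sectored D" and sub: "D \<subseteq> diagonals n"
      using D by (auto simp: dissections_def)
    \<comment> \<open>Iterating the invariance yields the nonnegative multiples of \<open>m\<close>;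
      reduction of \<open>j\<close> modulo \<open>d\<close> then covers all integers.\<close>
    have pow: "turn n (int i * m) e \<in> D" if "e \<in> D" for i e
    proof (induction i)
      case 0
      then show ?case using turn_0[OF diagonals_subset, of e n] sub that by auto
    next
      case (Suc i)
      have "turn n (int (Suc i) * m) e = turn n m (turn n (int i * m) e)"
        by (simp add: turn_turn algebra_simps)
      then show ?case using Suc inv by blast
    qed
    have all: "turn n (j * m) e \<in> D" if "e \<in> D" for j e
      using pow[OF that, of "nat (j mod int d)"] turn_mod[of j] d_ge by simp
    show ?thesis
    proof (intro equalityI subsetI)
      fix e assume "e \<in> spread (?r D)"
      then obtain j t where "e = turn n (j * m) (edge t)" "edge t \<in> D"
        unfolding spread_def by blast
      then show "e \<in> D" using all by simp
    next
      fix e assume e: "e \<in> D"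
      then obtain j t where t: "t \<in> arcs 0 m" "e = turn n (j * m) (edge t)"
        using sec unfolding sectored_def by blast
      have "turn n (- j * m) e = edge t"
        using turn_inverse[OF edge_subset[OF t(1)], of "j * m"] t(2) by simp
      then have tD: "edge t \<in> D" using all[OF e, of "- j"] by simp
      obtain x y where xy: "t = (x, y)" by (cases t)
      \<comment> \<open>\<open>sectored\<close> admits unit arcs, but these are sides of the
        polygon, so restricting to \<open>long_arcs m\<close> loses no diagonal.\<close>
      have "y \<noteq> x + 1"
      proof
        assume "y = x + 1"
        then have "{x, x + 1} \<in> diagonals n" using tD sub by (auto simp: xy)
        moreover have "(x + 1) mod int n = x + 1"
          using t(1) m_less \<open>y = x + 1\<close> by (simp add: xy)
        ultimately show False by (auto simp: diagonals_def doubleton_eq_iff)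
      qed
      then have "t \<in> ?r D" using t(1) tD by (simp add: xy)
      then show "e \<in> spread (?r D)" using t(2) unfolding spread_def by blast
    qed
  qed
  have m2: "(0, m) \<notin> ?r D" if "D \<in> ?X" "d = 2" for D using that by auto
  have "bij_betw spread ?Y ?X"
  proof (rule bij_betw_byWitness[where f' = ?r])
    show "\<forall>S\<in>?Y. ?r (spread S) = S"
    proof
      fix S assume S: "S \<in> ?Y"
      have Sl: "S \<subseteq> long_arcs m" using S by (simp add: long_families_def)
      have la: "long_arcs m \<subseteq> arcs 0 m" using arcs_eq by blast
      have "edge t \<in> spread S \<longleftrightarrow> t \<in> S" if "t \<in> long_arcs m" for t
        using spread_mem_iff[of S t] Sl la that S by blast
      then show "?r (spread S) = S" using Sl by blast
    qed
    show "\<forall>D\<in>?X. spread (?r D) = D" using spread_r by blast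
    show "spread ` ?Y \<subseteq> ?X"
    proof clarify
      fix S assume S: "S \<in> long_families m k" and nd: "d = 2 \<longrightarrow> (0, m) \<notin> S"
      have Sa: "S \<subseteq> arcs 0 m" using S arcs_eq by (auto simp: long_families_def)
      have "{0, m} \<notin> spread S" if "d = 2"
        using spread_mem_iff[of S "(0, m)"] Sa nd that m_pos by simp
      moreover have "sectored (spread S)" using Sa unfolding sectored_def spread_def by blast
      ultimately show "spread S \<in> dissections n (d * k) \<and> turn n m ` spread S = spread S \<and>
          sectored (spread S) \<and> (d = 2 \<longrightarrow> {0, m} \<notin> spread S)"
        using spread_dissection[OF S] nd spread_invariant by blast
    qed
    show "?r ` ?X \<subseteq> ?Y"
    proof
      fix S assume "S \<in> ?r ` ?X"
      then obtain D where D: "D \<in> ?X" and S: "S = ?r D" by blast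
      have sl: "S \<subseteq> long_arcs m" using S by blast
      then have sa: "S \<subseteq> arcs 0 m" using arcs_eq by blast
      have "edge ` S \<subseteq> D" using S by blast
      moreover have "\<forall>e\<in>D. \<forall>f\<in>D. \<not> crosses e f" using D by (simp add: dissections_def)
      ultimately have "\<forall>e\<in>edge ` S. \<forall>f\<in>edge ` S. \<not> crosses e f" by blast
      then have nc: "noncrossing S" using noncrossing_edges[OF sa] by blast
      have nd: "d = 2 \<Longrightarrow> (0, m) \<notin> S" using m2[OF D] S by simp
      have "d * card S = d * k"
        using card_spread[OF sa nd] spread_r[OF D] D S by (simp add: dissections_def)
      then have "card S = k" using d_ge by simp
      then show "S \<in> ?Y" using sl nc nd by (simp add: long_families_def)
    qed
  qed
  from bij_betw_same_card[OF this] show ?thesis by (rule sym)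
qed

end

section \<open>Symmetric almost-triangulations\<close>

definition fixed :: "nat \<Rightarrow> int \<Rightarrow> int set set set" where
  "fixed n g = {D \<in> dissections n (n - 4). turn n g ` D = D}"

lemma finite_fixed [simp]: "n \<ge> 3 \<Longrightarrow> finite (fixed n g)"
  by (simp add: fixed_def)

lemma fixedD:
  assumes "D \<in> fixed n g"
  shows "D \<in> dissections n (n - 4)" "turn n g ` D = D" "D \<subseteq> diagonals n"
  using assms by (auto simp: fixed_def dissections_def)

lemma completions_fixed:
  assumes "n > 0" "D \<in> fixed n g"
  shows "turn n g ` completions n D = completions n D"
  using completions_turn[OF assms(1) fixedD(3)[OF assms(2)], of g] fixedD(2)[OF assms(2)] by simp

lemma turn_set_turn: "turn n g ` turn n h ` D = turn n (g + h) ` D"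
  by (subst image_image) (simp only: turn_turn)

text \<open>A rotation that fixes \<open>D\<close> permutes the corners of its quadrilateral cell. Comparing the
  sums of the corners modulo \<open>n\<close> shows that its fourth power is trivial.\<close>

lemma fixed_dvd:
  assumes n: "n \<ge> 4" and D: "D \<in> fixed n g"
  shows "int n dvd 4 * g"
proof -
  obtain p q r s where *: "0 \<le> p" "p < q" "q < r" "r < s" "s < int n"
    and C: "completions n D = {{p, r}, {q, s}}" using completions_pair[OF n fixedD(1)[OF D]] .
  define V where "V = \<Union> (completions n D)"
  have "rotate_vertex n g ` V = V"
    using completions_fixed[OF _ D] n unfolding V_def image_Union by simp
  moreover have V: "V = {p, q, r, s}" by (auto simp: V_def C)
  moreover have "inj_on (rotate_vertex n g) V"
    using rotate_vertex_inj[of n] n * by (intro inj_onI) (auto simp: V)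
  ultimately have "(\<Sum>v\<in>V. v) = (\<Sum>v\<in>V. (v + g) mod int n)"
    using sum.reindex[of "rotate_vertex n g" V "\<lambda>v. v"] by (simp add: rotate_vertex_def)
  then have "(\<Sum>v\<in>V. v) mod int n = (\<Sum>v\<in>V. v + g) mod int n"
    by (simp add: mod_sum_eq)
  also have "(\<Sum>v\<in>V. v + g) = (\<Sum>v\<in>V. v) + 4 * g"
    using * by (simp add: V)
  finally show ?thesis by (simp add: mod_eq_dvd_iff)
qed

text \<open>The half turn permutes the four corners and exchanges the vertices below
  \<open>h\<close> with those from \<open>h\<close> on, so two corners lie in each half. It then
  sends the lower pair to the upper pair in order, which makes both addable diagonals
  diameters.\<close>

lemma half_completions:
  assumes n: "n \<ge> 4" and h: "int n = 2 * h" and D: "D \<in> fixed n h"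
  obtains p q where "0 \<le> p" "p < q" "q < h" "completions n D = {{p, p + h}, {q, q + h}}"
proof -
  obtain p q r s where *: "0 \<le> p" "p < q" "q < r" "r < s" "s < int n"
    and C: "completions n D = {{p, r}, {q, s}}" using completions_pair[OF n fixedD(1)[OF D]] .
  define V where "V = \<Union> (completions n D)"
  have im: "rotate_vertex n h ` V = V"
    using completions_fixed[OF _ D] n unfolding V_def image_Union by simp
  have V: "V = {p, q, r, s}" by (auto simp: V_def C)
  have rot: "(if v < h then v + h else v - h) \<in> {p, q, r, s}" if "v \<in> {p, q, r, s}" for v
  proof -
    have "v \<in> {0..<int n}" using that * by auto
    then have "rotate_vertex n h v = (if v < h then v + h else v - h)"
      using rotate_vertex_cases[of v n h] h n by auto
    then show ?thesis using im that unfolding V by (metis image_eqI)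
  qed
  have h0: "h > 0" using n h by simp
  have "p < h" using rot[of p] * h0 by (auto split: if_splits)
  \<comment> \<open>Otherwise \<open>q\<close>, \<open>r\<close>, \<open>s\<close> would be moved to
    three distinct corners below \<open>h\<close>, where only \<open>p\<close> lies.\<close>
  have "q < h"
  proof (rule ccontr)
    assume "\<not> q < h"
    then show False using rot[of q] rot[of r] rot[of s] * h h0 by (auto split: if_splits)
  qed
  have "h \<le> r"
  proof (rule ccontr)
    assume "\<not> h \<le> r"
    then show False using rot[of p] rot[of q] rot[of r] * h h0 by (auto split: if_splits)
  qed
  have "r = p + h" "s = q + h"
    using rot[of p] rot[of q] \<open>p < h\<close> \<open>q < h\<close> \<open>h \<le> r\<close> * by (auto split: if_splits)
  then show ?thesis using that * \<open>q < h\<close> C by blast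
qed

text \<open>The square of the quarter turn is the half turn, so both completions are diameters. The
  quarter turn carries the diameter at \<open>p\<close> to a different one, which must be the other
  completion.\<close>

lemma quarter_completions:
  assumes n: "n \<ge> 4" and m: "int n = 4 * m" and D: "D \<in> fixed n m"
  obtains p where "0 \<le> p" "p < m" "completions n D = {{p, p + 2 * m}, {p + m, p + 3 * m}}"
proof -
  have "turn n (2 * m) ` D = D"
    using turn_set_turn[of n m m D] fixedD(2)[OF D] by simp
  then have "D \<in> fixed n (2 * m)" using fixedD(1)[OF D] by (simp add: fixed_def)
  from half_completions[OF n _ this] m obtain p q where
    *: "0 \<le> p" "p < q" "q < 2 * m" and C: "completions n D = {{p, p + 2 * m}, {q, q + 2 * m}}"
    by auto
  have "{p, p + 2 * m} \<in> completions n D" by (simp add: C)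
  from imageI[OF this, of "turn n m"] have "turn n m {p, p + 2 * m} \<in> completions n D"
    using completions_fixed[OF _ D] n by (simp only:)
  then have t: "{rotate_vertex n m p, rotate_vertex n m (p + 2 * m)} \<in> {{p, p + 2 * m}, {q, q + 2 * m}}"
    by (simp add: C)
  have rp: "rotate_vertex n m p = p + m"
    using rotate_vertex_cases[of p n m] m * by auto
  \<comment> \<open>Otherwise \<open>p + 2 * m\<close> would be moved to \<open>p - m\<close>, a
    corner smaller than the smallest one.\<close>
  have "p < m"
  proof (rule ccontr)
    assume "\<not> p < m"
    then have "rotate_vertex n m (p + 2 * m) = p - m"
      using rotate_vertex_cases[of "p + 2 * m" n m] m * by auto
    then show False using t rp * by (auto simp: doubleton_eq_iff)
  qed
  then have "rotate_vertex n m (p + 2 * m) = p + 3 * m"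
    using rotate_vertex_cases[of "p + 2 * m" n m] m * by auto
  then have "q = p + m" using t rp * \<open>p < m\<close> by (auto simp: doubleton_eq_iff)
  then show ?thesis using that * \<open>p < m\<close> C by (simp add: algebra_simps)
qed

text \<open>Rotations commute, so turning by \<open>k\<close> permutes the dissections fixed by
  \<open>g\<close> and moves their completions along. Hence all diameters are completions equally
  often, and only \<open>{0, l}\<close> has to be studied.\<close>

lemma card_fixed_turn:
  assumes n: "n > 0" and e: "e \<subseteq> {0..<int n}"
  shows "card {D \<in> fixed n g. turn n k e \<in> completions n D} = card {D \<in> fixed n g. e \<in> completions n D}"
    (is "card ?A = card ?B")
proof -
  have step: "turn n j ` D \<in> {D \<in> fixed n g. turn n j f \<in> completions n D}"
    if "D \<in> {D \<in> fixed n g. f \<in> completions n D}" for j f D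
  proof -
    have D: "D \<in> fixed n g" and f: "f \<in> completions n D" using that by auto
    have "turn n g ` turn n j ` D = turn n j ` turn n g ` D"
      by (simp only: turn_set_turn add.commute)
    then have "turn n j ` D \<in> fixed n g"
      using turn_dissection[OF n fixedD(1)[OF D]] fixedD(2)[OF D] by (simp add: fixed_def)
    then show ?thesis using completions_turn[OF n fixedD(3)[OF D]] f by simp
  qed
  have "bij_betw (image (turn n k)) ?B ?A"
  proof (rule bij_betw_byWitness[where f' = "image (turn n (- k))"])
    show "\<forall>D\<in>?B. turn n (- k) ` turn n k ` D = D"
      using turn_set_inverse[OF fixedD(3), of _ n g k] by simp
    show "\<forall>D\<in>?A. turn n k ` turn n (- k) ` D = D"
      using turn_set_inverse[OF fixedD(3), of _ n g "- k"] by simp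
    show "image (turn n k) ` ?B \<subseteq> ?A" using step[of _ e k] by blast
    have "image (turn n (- k)) ` ?A \<subseteq> {D \<in> fixed n g. turn n (- k) (turn n k e) \<in> completions n D}"
      using step[of _ "turn n k e" "- k"] by blast
    then show "image (turn n (- k)) ` ?A \<subseteq> ?B" using turn_inverse[OF e] by simp
  qed
  from bij_betw_same_card[OF this] show ?thesis by (rule sym)
qed

lemma card_fixed_chord:
  assumes n: "n > 0" and k: "0 \<le> k" "k + l < int n" "0 \<le> l"
  shows "card {D \<in> fixed n g. {k, k + l} \<in> completions n D} = card {D \<in> fixed n g. {0, l} \<in> completions n D}"
proof -
  have "turn n k {0, l} = {k, k + l}" using k by (simp add: rotate_vertex_def add.commute)
  then show ?thesis using card_fixed_turn[OF n, of "{0, l}" g k] k by simp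
qed

lemma diagonal_endpoints:
  assumes "n \<ge> 3" "e \<in> diagonals n"
  obtains x y where "e = {x, y}" "0 \<le> x" "x + 2 \<le> y" "y < int n"
proof -
  obtain t where "t \<in> long_arcs (int n - 1)" "e = edge t"
    using assms diagonals_eq by blast
  then show ?thesis using that[of "fst t" "snd t"] by (cases t) auto
qed

text \<open>If the diameter \<open>{0, h}\<close> is addable, no member crosses it, so each lies
  within one half. The \<open>n - 4 = 2 * (h - 2)\<close> diagonals split evenly, and
  \<open>h - 2\<close> is the number that triangulates one \<open>(h + 1)\<close>-gon.\<close>

lemma half_sectored:
  assumes n: "n \<ge> 4" and h: "int n = 2 * h"
  shows "card {D \<in> fixed n h. {0, h} \<in> completions n D} = card (full 0 h)"
proof -
  interpret sectors n 2 h using n h by unfold_locales auto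
  define k where "k = nat (h - 2)"
  have k: "2 * k = n - 4" using n h by (simp add: k_def)
  have hd: "{0, h} \<in> diagonals n"
  proof -
    have "(0, h) \<in> long_arcs (int n - 1) - {(0, int n - 1)}" using n h by auto
    from imageI[OF this, of edge] show ?thesis using diagonals_eq[of n] n by simp
  qed
  have arcs: "\<exists>j. \<exists>t\<in>arcs 0 h. e = turn n (j * h) (edge t)"
    if e: "e \<in> diagonals n" "\<not> crosses {0, h} e" "e \<noteq> {0, h}" for e
  proof -
    obtain x y where xy: "e = {x, y}" "0 \<le> x" "x + 2 \<le> y" "y < int n"
      using diagonal_endpoints[OF _ e(1)] n by auto
    consider "y \<le> h" | "h \<le> x" | "x = 0" "h < y"
      using crossesI[of 0 x h y] e(2) xy by force
    then show ?thesis
    proof cases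
      case 1
      then show ?thesis using turn_0[of e n] xy
        by (intro exI[of _ 0] bexI[of _ "(x, y)"]) auto
    next
      case 2
      then show ?thesis using turn_sector[of "x - h" "y - h" 1] xy h
        by (intro exI[of _ 1] bexI[of _ "(x - h, y - h)"]) auto
    next
      case 3
      \<comment> \<open>A chord from 0 to some \<open>y > h\<close> belongs to the second half:
        vertex 0 is the image of the sector end \<open>h\<close>.\<close>
      then show ?thesis using turn_sector[of "y - h" h 1] xy h
        by (intro exI[of _ 1] bexI[of _ "(y - h, h)"]) auto
    qed
  qed
  have nocross: "\<not> crosses e {0, h}" if t: "t \<in> arcs 0 h" "e = turn n (j * h) (edge t)" for e j t
  proof (cases "j mod 2 = 0")
    case True
    have "(0, h) \<in> arcs 0 h" using m_pos by simp
    then have "\<not> crosses (edge t) (edge (0, h))"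
      using t(1) crosses_edge[of t 0 h "(0, h)"] by (cases t) (auto simp: crossing_def)
    then show ?thesis using t turn_mod[of j] True turn_0[OF edge_subset[OF t(1)]] by simp
  next
    case False
    then have "j mod 2 = 1" by presburger
    then show ?thesis
      using other_sector_not_crosses[OF t(1), of "(0, h)" 1] turn_mod[of j] t(2) m_pos by simp
  qed
  have "{D \<in> fixed n h. {0, h} \<in> completions n D} =
    {D \<in> dissections n (2 * k). turn n h ` D = D \<and> sectored D \<and> (2 = (2::nat) \<longrightarrow> {0, h} \<notin> D)}"
    (is "?A = ?B")
  proof (intro equalityI subsetI)
    fix D assume "D \<in> ?A"
    then have D: "D \<in> dissections n (n - 4)" "turn n h ` D = D" "{0, h} \<in> completions n D" "D \<subseteq> diagonals n"
      by (auto simp: fixed_def dissections_def)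
    have "sectored D" unfolding sectored_def
    proof
      fix e assume "e \<in> D"
      then have "e \<in> diagonals n" "\<not> crosses {0, h} e" "e \<noteq> {0, h}"
        using D(3,4) crosses_sym unfolding completions_def by auto
      then show "\<exists>j. \<exists>t\<in>arcs 0 h. e = turn n (j * h) (edge t)" by (rule arcs)
    qed
    then show "D \<in> ?B" using D k unfolding completions_def by simp
  next
    fix D assume "D \<in> ?B"
    then have D: "D \<in> dissections n (n - 4)" "turn n h ` D = D" "sectored D" "{0, h} \<notin> D"
      using k by simp_all
    have "\<not> crosses e {0, h}" if "e \<in> D" for e
      using bspec[OF D(3)[unfolded sectored_def] that] by (elim exE bexE) (rule nocross)
    then show "D \<in> ?A" using D hd unfolding completions_def fixed_def by simp
  qed
  then have "card {D \<in> fixed n h. {0, h} \<in> completions n D} =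
      card {S \<in> long_families h k. (0, h) \<notin> S}"
    using card_sectored[of k] by simp
  then show ?thesis using card_long_families_inner[of h] n h by (simp add: k_def)
qed

text \<open>The quarter turn sends \<open>{0, 2 * m}\<close> to \<open>{m, 3 * m}\<close>, so both
  diagonals of the square \<open>0, m, 2 * m, 3 * m\<close> are addable and every member lies within
  one of the four sectors. Each sector receives \<open>(n - 4) / 4 = m - 1\<close> diagonals, for
  \<open>m \<ge> 2\<close> including the side of the square.\<close>

lemma quarter_sectored:
  assumes n: "n \<ge> 4" and m: "int n = 4 * m"
  shows "card {D \<in> fixed n m. {0, 2 * m} \<in> completions n D} = card (full 0 m)"
proof -
  interpret sectors n 4 m using n m by unfold_locales auto
  define k where "k = nat (m - 1)"
  have k: "4 * k = n - 4" using n m by (simp add: k_def)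
  have hd: "{0, 2 * m} \<in> diagonals n"
  proof -
    have "(0, 2 * m) \<in> long_arcs (int n - 1) - {(0, int n - 1)}" using n m by auto
    from imageI[OF this, of edge] show ?thesis using diagonals_eq[of n] n by simp
  qed
  have arcs: "\<exists>j. \<exists>t\<in>arcs 0 m. e = turn n (j * m) (edge t)"
    if e: "e \<in> diagonals n" "\<not> crosses {0, 2 * m} e" "\<not> crosses {m, 3 * m} e"
      "e \<noteq> {0, 2 * m}" "e \<noteq> {m, 3 * m}" for e
  proof -
    obtain x y where xy: "e = {x, y}" "0 \<le> x" "x + 2 \<le> y" "y < int n"
      using diagonal_endpoints[OF _ e(1)] n by auto
    have "\<not> (0 < x \<and> x < 2 * m \<and> 2 * m < y)" using crossesI[of 0 x "2 * m" y] e(2) xy by auto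
    moreover have "\<not> (m < x \<and> x < 3 * m \<and> 3 * m < y)" using crossesI[of m x "3 * m" y] e(3) xy by auto
    moreover have "\<not> (x < m \<and> m < y \<and> y < 3 * m)"
      using crossesI[of x m y "3 * m"] e(3) xy crosses_sym by auto
    moreover have "\<not> (x = 0 \<and> y = 2 * m)" "\<not> (x = m \<and> y = 3 * m)" using e(4,5) xy by auto
    ultimately consider "y \<le> m" | "m \<le> x" "y \<le> 2 * m" | "2 * m \<le> x" "y \<le> 3 * m" | "3 * m \<le> x"
      | "x = 0" "3 * m \<le> y"
      using xy m m_pos by linarith
    then show ?thesis
    proof cases
      case 1
      then show ?thesis using turn_0[of e n] xy
        by (intro exI[of _ 0] bexI[of _ "(x, y)"]) auto
    next
      case 2
      then show ?thesis using turn_sector[of "x - m" "y - m" 1] xy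
        by (intro exI[of _ 1] bexI[of _ "(x - m, y - m)"]) auto
    next
      case 3
      then show ?thesis using turn_sector[of "x - 2 * m" "y - 2 * m" 2] xy
        by (intro exI[of _ 2] bexI[of _ "(x - 2 * m, y - 2 * m)"]) auto
    next
      case 4
      then show ?thesis using turn_sector[of "x - 3 * m" "y - 3 * m" 3] xy m
        by (intro exI[of _ 3] bexI[of _ "(x - 3 * m, y - 3 * m)"]) auto
    next
      case 5
      then show ?thesis using turn_sector[of "y - 3 * m" m 3] xy m
        by (intro exI[of _ 3] bexI[of _ "(y - 3 * m, m)"]) auto
    qed
  qed
  have sector: "\<exists>l\<in>{0, 1, 2, 3}. \<exists>x y. 0 \<le> x \<and> x < y \<and> y \<le> m \<and>
      e = {x + l * m, if l = 3 \<and> y = m then 0 else y + l * m}"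
    if t: "t \<in> arcs 0 m" "e = turn n (j * m) (edge t)" for e j t
  proof -
    obtain x y where xy: "t = (x, y)" by (cases t)
    have l: "0 \<le> j mod 4" "j mod 4 < 4" by auto
    then have l': "j mod 4 \<in> {0, 1, 2, 3}" by auto
    have "e = {x + j mod 4 * m, if j mod 4 = 3 \<and> y = m then 0 else y + j mod 4 * m}"
      using turn_sector[of x y "j mod 4"] t turn_mod[of j] l by (simp add: xy)
    then show ?thesis using t(1) l' by (intro bexI[OF _ l'] exI[of _ x] exI[of _ y]) (simp add: xy)
  qed
  have nocross: "\<not> crosses e {0, 2 * m}" "e \<noteq> {0, 2 * m}"
    if t: "t \<in> arcs 0 m" "e = turn n (j * m) (edge t)" for e j t
  proof -
    obtain l x y where l: "l \<in> {0, 1, 2, 3}" and xy: "0 \<le> x" "x < y" "y \<le> m"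
      and e: "e = {x + l * m, if l = 3 \<and> y = m then 0 else y + l * m}"
      using sector[OF t] by blast
    show "e \<noteq> {0, 2 * m}"
      using l xy m_pos unfolding e by (auto simp: doubleton_eq_iff split: if_splits)
    show "\<not> crosses e {0, 2 * m}"
      using l xy m_pos unfolding e crosses_def by (auto simp: doubleton_eq_iff split: if_splits)
  qed
  have "{D \<in> fixed n m. {0, 2 * m} \<in> completions n D} =
    {D \<in> dissections n (4 * k). turn n m ` D = D \<and> sectored D \<and> (4 = (2::nat) \<longrightarrow> {0, m} \<notin> D)}"
    (is "?A = ?B")
  proof (intro equalityI subsetI)
    fix D assume A: "D \<in> ?A"
    then have D: "D \<in> dissections n (n - 4)" "turn n m ` D = D" "{0, 2 * m} \<in> completions n D" "D \<subseteq> diagonals n"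
      by (auto simp: fixed_def dissections_def)
    have "turn n m {0, 2 * m} = {m, 3 * m}"
      using m m_pos by (simp add: rotate_vertex_def)
    moreover have "turn n m {0, 2 * m} \<in> completions n D"
      using imageI[OF D(3), of "turn n m"] completions_fixed[OF n_pos, of D m] A by simp
    ultimately have D': "{m, 3 * m} \<in> completions n D" by simp
    have "sectored D" unfolding sectored_def
    proof
      fix e assume "e \<in> D"
      then have "e \<in> diagonals n" "\<not> crosses {0, 2 * m} e" "\<not> crosses {m, 3 * m} e"
        "e \<noteq> {0, 2 * m}" "e \<noteq> {m, 3 * m}"
        using D(3,4) D' crosses_sym unfolding completions_def by auto
      then show "\<exists>j. \<exists>t\<in>arcs 0 m. e = turn n (j * m) (edge t)" by (rule arcs)
    qed
    then show "D \<in> ?B" using D k by simp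
  next
    fix D assume "D \<in> ?B"
    then have D: "D \<in> dissections n (n - 4)" "turn n m ` D = D" "sectored D"
      using k by simp_all
    have "\<not> crosses e {0, 2 * m} \<and> e \<noteq> {0, 2 * m}" if "e \<in> D" for e
      using bspec[OF D(3)[unfolded sectored_def] that] by (elim exE bexE) (intro conjI nocross)
    then show "D \<in> ?A" using D hd unfolding completions_def fixed_def by auto
  qed
  then have "card {D \<in> fixed n m. {0, 2 * m} \<in> completions n D} = card (long_families m k)"
    using card_sectored[of k] by simp
  then show ?thesis using card_long_families_max[of m] m_pos by (simp add: k_def)
qed

text \<open>Double counting of pairs of a fixed \<open>D\<close> and a diameter among its
  completions: there are \<open>h\<close> diameters, each a completion of equally many
  \<open>D\<close>, and every \<open>D\<close> has two. The diameters are indexed by their endpoint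
  \<open>k < h\<close>.\<close>

lemma card_fixed_half:
  assumes n: "n \<ge> 4" and h: "int n = 2 * h"
  shows "2 * real (card (fixed n h)) = real n / 2 * catalan (real n / 2 - 1)"
proof -
  let ?R = "\<lambda>D k. {k, k + h} \<in> completions n D"
  have h2: "h \<ge> 2" using n h by simp
  have two: "card {k \<in> {0..<h}. ?R D k} = 2" if D: "D \<in> fixed n h" for D
  proof -
    obtain p q where *: "0 \<le> p" "p < q" "q < h" "completions n D = {{p, p + h}, {q, q + h}}"
      using half_completions[OF n h D] .
    have "{k \<in> {0..<h}. ?R D k} = {p, q}"
      using * by (auto simp: doubleton_eq_iff)
    then show ?thesis using *(2) by simp
  qed
  have "\<forall>k\<in>{0..<h}. card {D \<in> fixed n h. ?R D k} = card (full 0 h)"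
    using card_fixed_chord[of n _ h h] half_sectored[OF n h] n h by simp
  then have "(\<Sum>D\<in>fixed n h. card {k \<in> {0..<h}. ?R D k}) = card (full 0 h) * card {0..<h}"
    using n by (intro sum_multicount) auto
  then have "card (fixed n h) * 2 = card (full 0 h) * nat h" using two by simp
  then have "2 * real (card (fixed n h)) = real (card (full 0 h)) * real (nat h)"
    by (metis mult.commute of_nat_mult of_nat_numeral)
  moreover have "real (card (full 0 h)) = catalan (of_int (h - 1))" using card_full[of 0 h] h2 by simp
  moreover have "real n / 2 = of_int h" "real (nat h) = of_int h"
    using h h2 by simp_all
  ultimately show ?thesis by simp
qed

text \<open>Counting over \<open>k < m\<close> picks, for each square, exactly one of its two
  diagonals: the one through its only corner in the first quarter.\<close>

lemma card_fixed_quarter: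
  assumes n: "n \<ge> 4" and m: "int n = 4 * m"
  shows "real (card (fixed n m)) = real n / 4 * catalan (real n / 4 - 1)"
proof -
  let ?R = "\<lambda>D k. {k, k + 2 * m} \<in> completions n D"
  have m1: "m \<ge> 1" using n m by simp
  have one: "card {k \<in> {0..<m}. ?R D k} = 1" if D: "D \<in> fixed n m" for D
  proof -
    obtain p where *: "0 \<le> p" "p < m" "completions n D = {{p, p + 2 * m}, {p + m, p + 3 * m}}"
      using quarter_completions[OF n m D] .
    have "{k \<in> {0..<m}. ?R D k} = {p}"
      using * by (auto simp: doubleton_eq_iff)
    then show ?thesis by simp
  qed
  have "\<forall>k\<in>{0..<m}. card {D \<in> fixed n m. ?R D k} = card (full 0 m)"
    using card_fixed_chord[of n _ "2 * m" m] quarter_sectored[OF n m] n m by simp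
  then have "(\<Sum>D\<in>fixed n m. card {k \<in> {0..<m}. ?R D k}) = card (full 0 m) * card {0..<m}"
    using n by (intro sum_multicount) auto
  then have "card (fixed n m) = card (full 0 m) * nat m" using one by simp
  then have "real (card (fixed n m)) = real (card (full 0 m)) * real (nat m)" by simp
  moreover have "real (card (full 0 m)) = catalan (of_int (m - 1))" using card_full[of 0 m] m1 by simp
  moreover have "real n / 4 = of_int m" "real (nat m) = of_int m"
    using m m1 by simp_all
  ultimately show ?thesis by simp
qed

section \<open>Counting orbits\<close>

lemma fixed_0:
  assumes "n > 0"
  shows "fixed n 0 = dissections n (n - 4)"
proof -
  have "turn n 0 ` D = D" if "D \<in> dissections n (n - 4)" for D
    using rotate_set_0[of D n] that by (simp add: dissections_def)
  then show ?thesis by (auto simp: fixed_def)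
qed

lemma fixed_three_quarters:
  assumes m: "int n = 4 * m"
  shows "fixed n (3 * m) = fixed n m"
proof -
  have "turn n (3 * m) ` D = D \<longleftrightarrow> turn n m ` D = D" if D: "D \<subseteq> diagonals n" for D
  proof
    assume *: "turn n m ` D = D"
    have "turn n (3 * m) ` D = turn n m ` turn n m ` turn n m ` D"
      by (simp only: turn_set_turn) simp
    then show "turn n (3 * m) ` D = D" by (simp add: *)
  next
    assume *: "turn n (3 * m) ` D = D"
    \<comment> \<open>The rotations by \<open>m\<close> and \<open>3 * m\<close> generate the same
      subgroup; explicitly \<open>9 * m = m + 2 * n\<close>, so three turns by \<open>3 * m\<close>
      make one by \<open>m\<close>.\<close>
    have "rotate_vertex n (9 * m) = rotate_vertex n m"
      by (rule rotate_vertex_cong) (simp add: m mod_eq_dvd_iff)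
    then have "turn n m ` D = turn n (9 * m) ` D" by simp
    also have "\<dots> = turn n (3 * m) ` turn n (3 * m) ` turn n (3 * m) ` D"
      by (simp only: turn_set_turn) simp
    also have "\<dots> = D" by (simp add: *)
    finally show "turn n m ` D = D" .
  qed
  then show ?thesis unfolding fixed_def dissections_def by (simp cong: conj_cong)
qed

text \<open>The value 0 at non-integers is what lets one formula cover all residues of
  \<open>n\<close> modulo 4: the Catalan term disappears exactly when the polygon has no such
  rotation.\<close>

lemma catalan_eq_0:
  assumes "\<And>k :: nat. int n \<noteq> c * (int k + 1)" "c > 0"
  shows "catalan (real n / of_int c - 1) = 0"
proof -
  have "real n / of_int c - 1 \<notin> \<nat>"
  proof
    assume "real n / of_int c - 1 \<in> \<nat>"
    then obtain k where "real n / of_int c - 1 = real k" by (auto simp: Nats_def)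
    then have "real n = of_int c * (real k + 1)" using assms(2) by (simp add: field_simps)
    then have "real_of_int (int n) = real_of_int (c * (int k + 1))" by simp
    then have "int n = c * (int k + 1)" by (simp only: of_int_eq_iff)
    then show False using assms(1) by blast
  qed
  then show ?thesis by (simp add: catalan_def)
qed

text \<open>By \<open>fixed_dvd\<close> only multiples of \<open>n / 4\<close> can contribute. If 4
  divides \<open>n\<close>, these are 0, the half turn and two quarter turns with equal counts; if
  \<open>n\<close> is twice an odd number, 0 and the half turn; if \<open>n\<close> is odd, only
  0.\<close>

lemma sum_card_fixed:
  assumes n: "n \<ge> 4"
  shows "(\<Sum>g\<in>{0..<int n}. real (card (fixed n g))) =
    real (card (dissections n (n - 4))) + real n / 4 * catalan (real n / 2 - 1)
      + real n / 2 * catalan (real n / 4 - 1)"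
proof -
  have restrict: "(\<Sum>g\<in>{0..<int n}. real (card (fixed n g))) = (\<Sum>g\<in>Z. real (card (fixed n g)))"
    if Z: "Z \<subseteq> {0..<int n}" "\<And>g. 0 \<le> g \<Longrightarrow> g < int n \<Longrightarrow> int n dvd 4 * g \<Longrightarrow> g \<in> Z" for Z
  proof (rule sum.mono_neutral_right)
    show "\<forall>g\<in>{0..<int n} - Z. real (card (fixed n g)) = 0"
    proof
      fix g assume "g \<in> {0..<int n} - Z"
      then have "fixed n g = {}" using Z(2) fixed_dvd[OF n] by fastforce
      then show "real (card (fixed n g)) = 0" by simp
    qed
  qed (use Z in auto)
  have dvd_cases: "4 * g = 0 \<or> 4 * g = int n \<or> 4 * g = 2 * int n \<or> 4 * g = 3 * int n"
    if g: "0 \<le> g" "g < int n" "int n dvd 4 * g" for g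
  proof -
    obtain c where c: "4 * g = int n * c" using g(3) by auto
    have "int n * c < int n * 4" "0 \<le> int n * c" using c g by linarith+
    then have "c < 4" "0 \<le> c" using n by (simp_all add: zero_le_mult_iff)
    then have "c \<in> {0, 1, 2, 3}" by auto
    then show ?thesis using c by auto
  qed
  have f0: "fixed n 0 = dissections n (n - 4)" using fixed_0 n by simp
  consider (quarter) m where "int n = 4 * m" | (half) h where "int n = 2 * h" "odd h" | (odd) "odd n"
  proof -
    have "\<exists>m. int n = 4 * m" if "even n" "even (int n div 2)"
      using that by presburger
    moreover have "int n = 2 * (int n div 2)" if "even n" using that by presburger
    ultimately show ?thesis using that by blast
  qed
  then show ?thesis
  proof cases
    case quarter
    have m1: "m \<ge> 1" using quarter n by simp
    have "(\<Sum>g\<in>{0..<int n}. real (card (fixed n g))) = (\<Sum>g\<in>{0, m, 2 * m, 3 * m}. real (card (fixed n g)))"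
      using dvd_cases quarter m1 by (intro restrict) force+
    also have "\<dots> = real (card (fixed n 0)) + real (card (fixed n (2 * m))) + 2 * real (card (fixed n m))"
      using m1 fixed_three_quarters[OF quarter] by simp
    finally show ?thesis
      using card_fixed_half[OF n, of "2 * m"] card_fixed_quarter[OF n quarter] quarter f0 by simp
  next
    case half
    have h: "h \<ge> 1" using half n by simp
    have "(\<Sum>g\<in>{0..<int n}. real (card (fixed n g))) = (\<Sum>g\<in>{0, h}. real (card (fixed n g)))"
    proof (rule restrict)
      fix g assume "0 \<le> g" "g < int n" "int n dvd 4 * g"
      from dvd_cases[OF this] have "g = 0 \<or> 2 * g = h \<or> g = h \<or> 2 * g = 3 * h"
        unfolding half(1) by linarith
      moreover have "2 * g \<noteq> h" "2 * g \<noteq> 3 * h" using half(2) by presburger+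
      ultimately show "g \<in> {0, h}" by blast
    qed (use half h in auto)
    moreover have "catalan (real n / of_int 4 - 1) = 0"
      using half by (intro catalan_eq_0) presburger+
    ultimately show ?thesis using card_fixed_half[OF n half(1)] h f0 by simp
  next
    case odd
    have "(\<Sum>g\<in>{0..<int n}. real (card (fixed n g))) = (\<Sum>g\<in>{0}. real (card (fixed n g)))"
    proof (rule restrict)
      fix g assume g: "0 \<le> g" "g < int n" "int n dvd 4 * g"
      have "odd (int n)" using odd by simp
      then have "4 * g \<noteq> int n" "4 * g \<noteq> 2 * int n" "4 * g \<noteq> 3 * int n" by presburger+
      then show "g \<in> {0}" using dvd_cases[OF g] by simp
    qed (use n in auto)
    moreover have "catalan (real n / of_int 4 - 1) = 0" "catalan (real n / of_int 2 - 1) = 0"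
      using odd by (intro catalan_eq_0; presburger)+
    ultimately show ?thesis using f0 by simp
  qed
qed

theorem theorem2:
  fixes n :: nat
  assumes "n \<ge> 4"
  shows "real (card (dissection_classes n (n - 4))) =
    (real n - 3) / (2 * real n) * catalan (real n - 2)
      + 1 / 2 * catalan (real n / 4 - 1) + 1 / 4 * catalan (real n / 2 - 1)"
proof -
  let ?G = "integer_mod_group n" and ?E = "dissections n (n - 4)"
  interpret group_action ?G ?E "rotation n (n - 4)"
    using assms by (intro rotation_group_action) simp
  have carr: "carrier ?G = {0..<int n}" using assms by (simp add: carrier_integer_mod_group)
  have inv: "invariants ?E (rotation n (n - 4)) g = fixed n g" for g
    by (auto simp: invariants_def fixed_def rotation_def)
  have "card (orbits ?G ?E (rotation n (n - 4))) * order ?G = (\<Sum>g\<in>carrier ?G. card (fixed n g))"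
    using burnside assms unfolding inv by (simp add: carr)
  then have "card (dissection_classes n (n - 4)) * n = (\<Sum>g\<in>{0..<int n}. card (fixed n g))"
    by (simp add: dissection_classes_def order_def carr)
  then have "real (card (dissection_classes n (n - 4))) * real n =
      (\<Sum>g\<in>{0..<int n}. real (card (fixed n g)))"
    by (metis of_nat_mult of_nat_sum)
  also have "\<dots> = (real n - 3) * catalan (real n - 2) / 2 + real n / 4 * catalan (real n / 2 - 1)
      + real n / 2 * catalan (real n / 4 - 1)"
    using sum_card_fixed[OF assms] card_almost_triangulations[OF assms] by simp
  finally show ?thesis using assms by (simp add: field_simps)
qed

end
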